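(* Let $\Lambda$ be a compact path-connected metric space and let $\mathbb{E}$ and $\mathbb{F}$ be subbundles of the trivial bundle $\Theta(\mathbb{R}^d)=\Lambda\times\mathbb{R}^d$. Then there exists a parametrized linear vector field $\mathbb{A}\colon\Lambda\times\mathbb{Z}\to GL(d,\mathbb{R})$ such that $L\colon\Lambda\to\mathcal{L}(\ell_0(\mathbb{R}^d))$, $(L(\lambda)\phi)(n)=\phi(n+1)-\mathbb{A}_n(\lambda)\phi(n)$, is a continuous family of Fredholm operators with $\operatorname{ind}(L)=[\mathbb{E}]-[\mathbb{F}]\in KO(\Lambda)$.
   Context: $\ell_0(\mathbb{R}^d)$: sequences $\mathbb{Z}\to\mathbb{R}^d$ converging to $0$ at $\pm\infty$, sup norm. $KO(\Lambda)$: Grothendieck group of isomorphism classes of real vector bundles over $\Lambda$. Index bundle: for a continuous family $L\colon\Lambda\to\Phi(X,Y)$ of Fredholm operators between Banach spaces, choose a finite-dimensional $V\subset Y$ with $\operatorname{im}L(\lambda)+V=Y$ for all $\lambda$; then $E(L,V):=\bigcup_\lambda\{\lambda\}\times L(\lambda)^{-1}(V)$ is a vector bundle and $\operatorname{ind}(L):=[E(L,V)]-[\Lambda\times V]\in KO(\Lambda)$. *)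

theory Defs
  imports "HOL-Analysis.Analysis"
begin

text \<open>The Banach space ell_0(R^d): sequences Z -> R^d tending to 0 at both ends,
  realised as a (closed) subspace of the sup-normed space of bounded functions
  int =>C real^'d.\<close>
definition ell0 :: "(int \<Rightarrow>\<^sub>C (real^'d)) set" where
  "ell0 = {f. ((\<lambda>n. apply_bcontfun f n) \<longlongrightarrow> 0) at_top \<and>
              ((\<lambda>n. apply_bcontfun f n) \<longlongrightarrow> 0) at_bot}"

definition fin_dim_subspace :: "'v::real_vector set \<Rightarrow> bool" where
  "fin_dim_subspace V \<longleftrightarrow> (\<exists>B. finite B \<and> V = span B)"

definition bounded_linear_on :: "'v::real_normed_vector set \<Rightarrow> ('v \<Rightarrow> 'v) \<Rightarrow> bool" where
  "bounded_linear_on X T \<longleftrightarrow> T ` X \<subseteq> X \<and>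
     (\<forall>u\<in>X. \<forall>v\<in>X. T (u + v) = T u + T v) \<and>
     (\<forall>c. \<forall>u\<in>X. T (c *\<^sub>R u) = c *\<^sub>R T u) \<and>
     (\<exists>K. \<forall>u\<in>X. norm (T u) \<le> K * norm u)"

definition fredholm_on :: "'v::real_normed_vector set \<Rightarrow> ('v \<Rightarrow> 'v) \<Rightarrow> bool" where
  "fredholm_on X T \<longleftrightarrow> bounded_linear_on X T \<and>
     fin_dim_subspace {u\<in>X. T u = 0} \<and>
     closed (T ` X) \<and>
     (\<exists>W. fin_dim_subspace W \<and> W \<subseteq> X \<and> {y + w | y w. y \<in> T ` X \<and> w \<in> W} = X)"

text \<open>Finite rank (locally trivial) vector bundle given as a subbundle of the trivial
  bundle Lambda \<times> 'v: fibres are linear subspaces, and locally there are continuous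
  frames (sections forming a basis of every fibre).\<close>
definition vbundle :: "'a::metric_space set \<Rightarrow> ('a \<Rightarrow> 'v::real_normed_vector set) \<Rightarrow> bool" where
  "vbundle \<Lambda> E \<longleftrightarrow> (\<forall>l\<in>\<Lambda>. subspace (E l)) \<and>
     (\<forall>l0\<in>\<Lambda>. \<exists>U k (s :: nat \<Rightarrow> 'a \<Rightarrow> 'v).
        openin (top_of_set \<Lambda>) U \<and> l0 \<in> U \<and>
        (\<forall>i<k. continuous_on U (s i)) \<and>
        (\<forall>l\<in>U. inj_on (\<lambda>i. s i l) {..<k} \<and>
                independent ((\<lambda>i. s i l) ` {..<k}) \<and>
                span ((\<lambda>i. s i l) ` {..<k}) = E l))"

definition subbundle_of :: "'a::metric_space set \<Rightarrow> 'v::real_normed_vector set \<Rightarrow> ('a \<Rightarrow> 'v set) \<Rightarrow> bool" where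
  "subbundle_of \<Lambda> X E \<longleftrightarrow> vbundle \<Lambda> E \<and> (\<forall>l\<in>\<Lambda>. E l \<subseteq> X)"

definition bundle_iso :: "'a::metric_space set \<Rightarrow> ('a \<Rightarrow> 'v::real_normed_vector set)
    \<Rightarrow> ('a \<Rightarrow> 'w::real_normed_vector set) \<Rightarrow> bool" where
  "bundle_iso \<Lambda> E F \<longleftrightarrow> (\<exists>(\<phi> :: 'a \<Rightarrow> 'v \<Rightarrow> 'w) (\<psi> :: 'a \<Rightarrow> 'w \<Rightarrow> 'v).
     (\<forall>l\<in>\<Lambda>. (\<forall>u\<in>E l. \<forall>v\<in>E l. \<phi> l (u + v) = \<phi> l u + \<phi> l v) \<and>
             (\<forall>c. \<forall>u\<in>E l. \<phi> l (c *\<^sub>R u) = c *\<^sub>R \<phi> l u) \<and>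
             (\<forall>u\<in>E l. \<phi> l u \<in> F l \<and> \<psi> l (\<phi> l u) = u) \<and>
             (\<forall>w\<in>F l. \<psi> l w \<in> E l \<and> \<phi> l (\<psi> l w) = w)) \<and>
     continuous_on (SIGMA l:\<Lambda>. E l) (\<lambda>(l, u). \<phi> l u) \<and>
     continuous_on (SIGMA l:\<Lambda>. F l) (\<lambda>(l, w). \<psi> l w))"

definition bsum :: "('a \<Rightarrow> 'v set) \<Rightarrow> ('a \<Rightarrow> 'w set) \<Rightarrow> ('a \<Rightarrow> ('v \<times> 'w) set)" where
  "bsum E F = (\<lambda>l. E l \<times> F l)"

text \<open>Equality [E1] - [F1] = [E2] - [F2] in KO(Lambda), unfolded from the Grothendieck
  construction on the monoid of isomorphism classes: E1 + F2 + G \<cong> E2 + F1 + G for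
  some vector bundle G.  G is represented as a bundle with fibres in the universal
  ambient space nat =>C real (every finite-rank bundle over a compact metric space
  is isomorphic to one of these).\<close>
definition KO_eq :: "'a::metric_space set \<Rightarrow> ('a \<Rightarrow> 'v1::real_normed_vector set)
    \<Rightarrow> ('a \<Rightarrow> 'w1::real_normed_vector set) \<Rightarrow> ('a \<Rightarrow> 'v2::real_normed_vector set)
    \<Rightarrow> ('a \<Rightarrow> 'w2::real_normed_vector set) \<Rightarrow> bool" where
  "KO_eq \<Lambda> E1 F1 E2 F2 \<longleftrightarrow> (\<exists>G :: 'a \<Rightarrow> (nat \<Rightarrow>\<^sub>C real) set. vbundle \<Lambda> G \<and>
      bundle_iso \<Lambda> (bsum (bsum E1 F2) G) (bsum (bsum E2 F1) G))"

definition op_family_continuous :: "'a::metric_space set \<Rightarrow> 'v::real_normed_vector set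
    \<Rightarrow> ('a \<Rightarrow> 'v \<Rightarrow> 'v) \<Rightarrow> bool" where
  "op_family_continuous \<Lambda> X L \<longleftrightarrow> (\<forall>l0\<in>\<Lambda>. \<forall>e>0. \<exists>\<delta>>0. \<forall>l\<in>\<Lambda>. dist l l0 < \<delta> \<longrightarrow>
      (\<forall>u\<in>X. norm (L l u - L l0 u) \<le> e * norm u))"

definition index_admissible :: "'a set \<Rightarrow> 'v::real_normed_vector set \<Rightarrow> ('a \<Rightarrow> 'v \<Rightarrow> 'v) \<Rightarrow> 'v set \<Rightarrow> bool" where
  "index_admissible \<Lambda> X L V \<longleftrightarrow> fin_dim_subspace V \<and> V \<subseteq> X \<and>
     (\<forall>l\<in>\<Lambda>. {y + v | y v. y \<in> L l ` X \<and> v \<in> V} = X)"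

definition index_fibres :: "'v set \<Rightarrow> ('a \<Rightarrow> 'v \<Rightarrow> 'v) \<Rightarrow> 'v set \<Rightarrow> 'a \<Rightarrow> 'v set" where
  "index_fibres X L V = (\<lambda>l. {u \<in> X. L l u \<in> V})"

definition index_bundle_eq :: "'a::metric_space set \<Rightarrow> 'v::real_normed_vector set \<Rightarrow> ('a \<Rightarrow> 'v \<Rightarrow> 'v)
    \<Rightarrow> ('a \<Rightarrow> 'e::real_normed_vector set) \<Rightarrow> ('a \<Rightarrow> 'f::real_normed_vector set) \<Rightarrow> bool" where
  "index_bundle_eq \<Lambda> X L E F \<longleftrightarrow> (\<exists>V. index_admissible \<Lambda> X L V) \<and>
     (\<forall>V. index_admissible \<Lambda> X L V \<longrightarrow>
        vbundle \<Lambda> (index_fibres X L V) \<and>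
        KO_eq \<Lambda> (index_fibres X L V) (\<lambda>l. V) E F)"

end

theory Submission
  imports Defs
begin

text \<open>Let \<open>P\<close> and \<open>Q\<close> be the orthogonal projections onto the fibres of \<open>E\<close> and \<open>F\<close>, and let the system be
  constant on each half-line: for \<open>n \<ge> 0\<close> it contracts \<open>E\<close> and expands the complement of \<open>E\<close>, for
  \<open>n < 0\<close> it contracts \<open>F\<close> and expands the complement of \<open>F\<close>. A solution of \<open>L u = y\<close> in \<open>ell0\<close>
  with \<open>u 0 = x\<close> exists iff \<open>x - Sp y \<in> E\<close> and \<open>Q (x - Sm y) = 0\<close>, where \<open>Sp\<close> and \<open>Sm\<close> are
  bounded functionals that do not depend on the parameter. Hence \<open>u \<mapsto> (u 0 - Sp (L u), L u)\<close> identifies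
  the index fibre over \<open>V\<close> with the kernel of the surjection \<open>E \<times> V \<rightarrow> F\<close>,
  \<open>(e, v) \<mapsto> Q (e + Sp v - Sm v)\<close>. Splitting this surjection by its Moore--Penrose inverse gives an
  isomorphism of (index bundle) \<open>\<oplus> F\<close> with \<open>E \<oplus> V\<close>.\<close>

subsection \<open>Frames and vector bundles\<close>

text \<open>Why the index is [E] - [F]: a homogeneous solution stays bounded forward iff it starts
  in \<open>E\<close>, backward iff it starts in the kernel of \<open>Q\<close>. So the kernel of
  the operator is \<open>E \<inter> ker Q\<close> and its cokernel is \<open>F / Q E\<close>. Both
  may jump in dimension with the parameter; only their formal difference is stable, which is why the
  surjection from \<open>E \<times> V\<close> replaces them. \<open>E\<close> and \<open>F\<close>
  may be nontrivial bundles, so the system is built from projections, which exist globally, and not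
  from frames. It acts as a scalar on the range and on the kernel of a projection; bounded solutions
  are therefore given by geometric series with scalar weights, to which the projection is applied
  only afterwards. Hence \<open>Sp\<close> and \<open>Sm\<close> are the same for all parameters.
  The obstacle: local triviality of the index fibres, inside an infinite-dimensional space, has to
  be shown for every admissible \<open>V\<close>. The isomorphism is therefore constructed first, on
  total spaces, and local triviality of the summand is read off from it. Continuity of its inverse
  rests on an a priori estimate whose constants do not depend on the projections.\<close>

definition lin_indep :: "nat \<Rightarrow> (nat \<Rightarrow> 'v::real_vector) \<Rightarrow> bool" where
  "lin_indep k s \<longleftrightarrow> (\<forall>c. (\<Sum>i<k. c i *\<^sub>R s i) = 0 \<longrightarrow> (\<forall>i<k. c i = 0))"

text \<open>Indexed families with explicit coefficients: repetitions are excluded automatically, and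
  a frame can be perturbed term by term. Only the first \<open>k\<close> values of a coefficient
  function matter.\<close>

definition frame :: "nat \<Rightarrow> (nat \<Rightarrow> 'v::real_vector) \<Rightarrow> 'v set \<Rightarrow> bool" where
  "frame k s W \<longleftrightarrow> lin_indep k s \<and> W = range (\<lambda>c. \<Sum>i<k. c i *\<^sub>R s i)"

lemma lin_indepD: "lin_indep k s \<Longrightarrow> (\<Sum>i<k. c i *\<^sub>R s i) = 0 \<Longrightarrow> i < k \<Longrightarrow> c i = 0"
  unfolding lin_indep_def by blast

lemma span_lessThan: "span (s ` {..<k}) = range (\<lambda>c. \<Sum>i<k. c i *\<^sub>R s i)"
  for s :: "nat \<Rightarrow> 'v::real_vector"
proof
  have "subspace (range (\<lambda>c. \<Sum>i<k. c i *\<^sub>R s i))"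
  proof (rule subspaceI)
    show "0 \<in> range (\<lambda>c. \<Sum>i<k. c i *\<^sub>R s i)"
      by (rule range_eqI[of _ _ "\<lambda>_. 0"]) simp
  next
    fix x y assume "x \<in> range (\<lambda>c. \<Sum>i<k. c i *\<^sub>R s i)" "y \<in> range (\<lambda>c. \<Sum>i<k. c i *\<^sub>R s i)"
    then obtain c d where "x = (\<Sum>i<k. c i *\<^sub>R s i)" "y = (\<Sum>i<k. d i *\<^sub>R s i)" by auto
    then show "x + y \<in> range (\<lambda>c. \<Sum>i<k. c i *\<^sub>R s i)"
      by (intro range_eqI[of _ _ "\<lambda>i. c i + d i"]) (simp add: sum.distrib scaleR_add_left)
  next
    fix r x assume "x \<in> range (\<lambda>c. \<Sum>i<k. c i *\<^sub>R s i)"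
    then obtain c where "x = (\<Sum>i<k. c i *\<^sub>R s i)" by auto
    then show "r *\<^sub>R x \<in> range (\<lambda>c. \<Sum>i<k. c i *\<^sub>R s i)"
      by (intro range_eqI[of _ _ "\<lambda>i. r * c i"]) (simp add: scaleR_sum_right)
  qed
  moreover have "s ` {..<k} \<subseteq> range (\<lambda>c. \<Sum>i<k. c i *\<^sub>R s i)"
  proof clarsimp
    fix j assume "j < k"
    then show "s j \<in> range (\<lambda>c. \<Sum>i<k. c i *\<^sub>R s i)"
      by (intro range_eqI[of _ _ "\<lambda>i. if i = j then 1 else 0"])
        (simp add: if_distrib[of "\<lambda>t. t *\<^sub>R _"] cong: if_cong)
  qed
  ultimately show "span (s ` {..<k}) \<subseteq> range (\<lambda>c. \<Sum>i<k. c i *\<^sub>R s i)"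
    by (rule span_minimal[rotated])
  show "range (\<lambda>c. \<Sum>i<k. c i *\<^sub>R s i) \<subseteq> span (s ` {..<k})"
    by (auto intro!: span_sum span_scale intro: span_base)
qed

lemma lin_indep_iff_independent:
  "lin_indep k s \<longleftrightarrow> inj_on s {..<k} \<and> independent (s ` {..<k})"
proof
  assume L: "lin_indep k s"
  have inj: "inj_on s {..<k}"
  proof (rule inj_onI, rule ccontr)
    fix i j assume ij: "i \<in> {..<k}" "j \<in> {..<k}" "s i = s j" "i \<noteq> j"
    let ?c = "\<lambda>n. (if n = i then 1 else 0) - (if n = j then 1 else (0::real))"
    have "(\<Sum>n<k. ?c n *\<^sub>R s n) = 0"
      using ij by (simp add: scaleR_diff_left sum_subtractf if_distrib[of "\<lambda>t. t *\<^sub>R _"] cong: if_cong)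
    then have "?c i = 0"
      using lin_indepD[of k s ?c i] L ij(1) by blast
    then show False using ij by simp
  qed
  moreover have "independent (s ` {..<k})"
  proof (rule independent_if_scalars_zero)
    fix f x assume "(\<Sum>x\<in>s ` {..<k}. f x *\<^sub>R x) = 0" "x \<in> s ` {..<k}"
    then have 0: "(\<Sum>i<k. f (s i) *\<^sub>R s i) = 0" and x: "x \<in> s ` {..<k}"
      by (simp_all add: sum.reindex[OF inj])
    show "f x = 0"
      using lin_indepD[of k s "\<lambda>i. f (s i)", OF L 0] x by auto
  qed simp
  ultimately show "inj_on s {..<k} \<and> independent (s ` {..<k})" ..
next
  assume *: "inj_on s {..<k} \<and> independent (s ` {..<k})"
  show "lin_indep k s" unfolding lin_indep_def
  proof (intro allI impI)
    fix c i assume 0: "(\<Sum>i<k. c i *\<^sub>R s i) = 0" and i: "i < k"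
    let ?f = "\<lambda>x. c (the_inv_into {..<k} s x)"
    have "(\<Sum>x\<in>s ` {..<k}. ?f x *\<^sub>R x) = (\<Sum>i<k. c i *\<^sub>R s i)"
      using * by (simp add: sum.reindex the_inv_into_f_f)
    with 0 have "?f (s i) = 0"
      using * i by (auto dest!: independentD[of _ "s ` {..<k}" ?f "s i"])
    then show "c i = 0" using * i by (simp add: the_inv_into_f_f)
  qed
qed

lemma frame_iff_basis:
  "frame k s W \<longleftrightarrow> inj_on s {..<k} \<and> independent (s ` {..<k}) \<and> span (s ` {..<k}) = W"
  unfolding frame_def lin_indep_iff_independent span_lessThan by blast

lemma frame_dim: "frame k s W \<Longrightarrow> dim W = k"
  unfolding frame_iff_basis by (metis card_image card_lessThan dim_span_eq_card_independent)

lemma frame_exists: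
  assumes "subspace W" "W \<subseteq> span B" "finite B"
  obtains k s where "frame k s W"
proof -
  obtain C where C: "C \<subseteq> W" "independent C" "W \<subseteq> span C"
    using maximal_independent_subset[of W] by blast
  have fin: "finite C"
    using independent_span_bound[OF assms(3) C(2)] C(1) assms(2) by blast
  have "span C = W"
    using C assms(1) by (metis span_minimal subset_antisym)
  moreover obtain s where "bij_betw s {..<card C} C"
    using ex_bij_betw_nat_finite[OF fin] by (auto simp: atLeast0LessThan)
  ultimately have "frame (card C) s W"
    using C unfolding frame_iff_basis bij_betw_def by simp
  then show thesis by (rule that)
qed

text \<open>Steinitz exchange: a vector of \<open>W\<close> outside the span would give
  \<open>k + 1\<close> independent vectors in a space spanned by \<open>k\<close>. In
  \<open>vbundle_summand\<close> this saves checking that perturbed sections still span.\<close>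

lemma frame_of_indep:
  assumes "frame k t W" "lin_indep k s" "\<And>i. i < k \<Longrightarrow> s i \<in> W"
  shows "frame k s W"
proof -
  have s: "inj_on s {..<k}" "independent (s ` {..<k})"
    using assms(2) unfolding lin_indep_iff_independent by auto
  have t: "inj_on t {..<k}" "independent (t ` {..<k})" "span (t ` {..<k}) = W"
    using assms(1) unfolding frame_iff_basis by auto
  have "W \<subseteq> span (s ` {..<k})"
  proof (rule ccontr)
    assume "\<not> ?thesis"
    then obtain x where x: "x \<in> W" "x \<notin> span (s ` {..<k})" by blast
    then have "independent (insert x (s ` {..<k}))"
      using s(2) by (simp add: independent_insert)
    moreover have "insert x (s ` {..<k}) \<subseteq> span (t ` {..<k})"
      using x t(3) assms(3) by auto
    ultimately have le: "card (insert x (s ` {..<k})) \<le> card (t ` {..<k})"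
      using independent_span_bound[of "t ` {..<k}" "insert x (s ` {..<k})"] by simp
    have "x \<notin> s ` {..<k}" using x(2) span_superset[of "s ` {..<k}"] by (rule contra_subsetD[rotated])
    then have "card (insert x (s ` {..<k})) = Suc k"
      using s(1) by (simp add: card_image)
    then show False using le t(1) by (simp add: card_image)
  qed
  moreover have "span (s ` {..<k}) \<subseteq> W"
    using assms(3) subspace_span[of "t ` {..<k}"] unfolding t(3) by (intro span_minimal) auto
  ultimately show ?thesis using s unfolding frame_iff_basis by blast
qed

lemma sum_lessThan_split: "(\<Sum>i<k+m. f i) = (\<Sum>i<k. f i) + (\<Sum>j<m. f (k + j))"
  for f :: "nat \<Rightarrow> 'b::comm_monoid_add"
  by (induction m) (simp_all add: add.assoc)

lemma frame_Times:
  assumes "frame k s S" "frame m t T"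
  shows "frame (k + m) (\<lambda>i. if i < k then (s i, 0) else (0, t (i - k))) (S \<times> T)"
proof -
  let ?r = "\<lambda>i. if i < k then (s i, 0) else (0, t (i - k))"
  have eq: "(\<Sum>i<k+m. c i *\<^sub>R ?r i) = ((\<Sum>i<k. c i *\<^sub>R s i), (\<Sum>j<m. c (k + j) *\<^sub>R t j))" for c
    by (simp add: sum_lessThan_split scaleR_Pair prod_eq_iff fst_sum snd_sum)
  have "lin_indep (k + m) ?r"
    unfolding lin_indep_def
  proof (intro allI impI)
    fix c i assume 0: "(\<Sum>i<k+m. c i *\<^sub>R ?r i) = 0" and i: "i < k + m"
    then have "(\<Sum>i<k. c i *\<^sub>R s i) = 0" "(\<Sum>j<m. c (k + j) *\<^sub>R t j) = 0"
      unfolding eq by (auto simp: zero_prod_def)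
    then have 1: "\<forall>i<k. c i = 0" and 2: "\<forall>j<m. c (k + j) = 0"
      using assms lin_indepD[of k s c] lin_indepD[of m t "\<lambda>j. c (k + j)"]
      unfolding frame_def by auto
    show "c i = 0"
    proof (cases "i < k")
      case False
      then have "i - k < m" "k + (i - k) = i" using i by auto
      then show ?thesis using 2 by metis
    qed (use 1 in auto)
  qed
  moreover have "S \<times> T = range (\<lambda>c. \<Sum>i<k+m. c i *\<^sub>R ?r i)"
  proof (intro equalityI subsetI)
    fix z assume "z \<in> S \<times> T"
    then obtain c d where z: "z = ((\<Sum>i<k. c i *\<^sub>R s i), (\<Sum>j<m. d j *\<^sub>R t j))"
      using assms unfolding frame_def by auto
    show "z \<in> range (\<lambda>c. \<Sum>i<k+m. c i *\<^sub>R ?r i)"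
      unfolding eq by (rule range_eqI[of _ _ "\<lambda>i. if i < k then c i else d (i - k)"]) (simp add: z)
  next
    fix z assume "z \<in> range (\<lambda>c. \<Sum>i<k+m. c i *\<^sub>R ?r i)"
    then show "z \<in> S \<times> T" using assms unfolding eq frame_def by auto
  qed
  ultimately show ?thesis unfolding frame_def by blast
qed

text \<open>Bundle morphisms are total functions constrained only on fibres, so linearity is assumed
  on \<open>W\<close> alone and the partial sums must be kept inside \<open>W\<close>.\<close>

lemma sum_on_subspace:
  fixes W :: "'v::real_vector set" and \<phi> :: "'v \<Rightarrow> 'w::real_vector"
  assumes W: "subspace W"
    and add: "\<And>u v. u \<in> W \<Longrightarrow> v \<in> W \<Longrightarrow> \<phi> (u + v) = \<phi> u + \<phi> v"
    and scale: "\<And>c u. u \<in> W \<Longrightarrow> \<phi> (c *\<^sub>R u) = c *\<^sub>R \<phi> u"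
    and s: "\<And>i. i < k \<Longrightarrow> s i \<in> W"
  shows "\<phi> (\<Sum>i<k. c i *\<^sub>R s i) = (\<Sum>i<k::nat. c i *\<^sub>R \<phi> (s i))"
  using s
proof (induction k)
  case 0
  then show ?case using scale[of 0 0] subspace_0[OF W] by simp
next
  case (Suc k)
  have "(\<Sum>i<k. c i *\<^sub>R s i) \<in> W" "c k *\<^sub>R s k \<in> W"
    using Suc.prems W by (auto intro!: subspace_sum subspace_scale)
  then show ?case using Suc by (simp add: add scale)
qed

lemma frame_transfer:
  fixes W :: "'v::real_vector set" and \<phi> :: "'v \<Rightarrow> 'w::real_vector"
  assumes fr: "frame k s W"
    and add: "\<And>u v. u \<in> W \<Longrightarrow> v \<in> W \<Longrightarrow> \<phi> (u + v) = \<phi> u + \<phi> v"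
    and scale: "\<And>c u. u \<in> W \<Longrightarrow> \<phi> (c *\<^sub>R u) = c *\<^sub>R \<phi> u"
    and bij: "bij_betw \<phi> W W'"
  shows "frame k (\<lambda>i. \<phi> (s i)) W'"
proof -
  have W: "subspace W" using fr unfolding frame_iff_basis by (metis subspace_span)
  have s: "s i \<in> W" if "i < k" for i
    using fr that unfolding frame_iff_basis by (metis imageI lessThan_iff span_base)
  note eq = sum_on_subspace[OF W add scale s, symmetric]
  have z: "\<phi> 0 = 0" using scale[of 0 0] subspace_0[OF W] by simp
  have 1: "(\<Sum>i<k. c i *\<^sub>R s i) = 0" if "(\<Sum>i<k. c i *\<^sub>R \<phi> (s i)) = 0" for c
  proof -
    have "\<phi> (\<Sum>i<k. c i *\<^sub>R s i) = \<phi> 0" using that by (simp add: eq z)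
    moreover have "(\<Sum>i<k. c i *\<^sub>R s i) \<in> W" "0 \<in> W"
      using s W by (auto intro!: subspace_sum subspace_scale subspace_0)
    ultimately show ?thesis using bij unfolding bij_betw_def inj_on_def by blast
  qed
  have "lin_indep k (\<lambda>i. \<phi> (s i))"
    unfolding lin_indep_def using fr lin_indepD[OF _ 1] unfolding frame_def by blast
  moreover have "W' = range (\<lambda>c. \<Sum>i<k. c i *\<^sub>R \<phi> (s i))"
    using bij fr unfolding bij_betw_def frame_def by (auto simp: eq)
  ultimately show ?thesis unfolding frame_def by blast
qed

text \<open>Compactness of the unit sphere of the coefficient space, realised inside the
  product \<open>[-1,1]\<^sup>\<nat>\<close>, bounds the coefficients by the norm of the combination.\<close>
lemma lin_indep_lower_bound:
  fixes b :: "nat \<Rightarrow> 'v::real_normed_vector"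
  assumes "lin_indep k b"
  obtains m where "m > 0" "\<And>c. m * (\<Sum>i<k. \<bar>c i\<bar>) \<le> norm (\<Sum>i<k. c i *\<^sub>R b i)"
proof (cases "k = 0")
  case True
  then show thesis by (intro that[of 1]) auto
next
  case False
  define K where "K = (PiE UNIV (\<lambda>_::nat. {-1..1::real})) \<inter> {c. (\<Sum>i<k. \<bar>c i\<bar>) = 1}"
  have "compact (PiE UNIV (\<lambda>_::nat. {-1..1::real}))"
    using compactin_PiE[of "\<lambda>_. euclidean" UNIV "\<lambda>_::nat. {-1..1::real}"]
    by (simp add: euclidean_product_topology)
  moreover have co: "continuous_on UNIV (\<lambda>c::nat\<Rightarrow>real. c i)" for i
    by (rule continuous_on_product_coordinates)
  then have "closed {c::nat\<Rightarrow>real. (\<Sum>i<k. \<bar>c i\<bar>) = 1}"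
    by (intro closed_Collect_eq continuous_intros)
  ultimately have K: "compact K" unfolding K_def by (rule compact_Int_closed)
  have "(\<lambda>i. if i = 0 then 1 else 0) \<in> K"
    using False unfolding K_def by (auto simp: if_distrib[of abs] cong: if_cong)
  then have "K \<noteq> {}" by blast
  moreover have "continuous_on K (\<lambda>c. norm (\<Sum>i<k. c i *\<^sub>R b i))"
    by (intro continuous_intros continuous_on_subset[OF co]) auto
  ultimately obtain c0 where c0: "c0 \<in> K"
    "\<And>c. c \<in> K \<Longrightarrow> norm (\<Sum>i<k. c0 i *\<^sub>R b i) \<le> norm (\<Sum>i<k. c i *\<^sub>R b i)"
    using continuous_attains_inf[OF K] by blast
  define m where "m = norm (\<Sum>i<k. c0 i *\<^sub>R b i)"
  have "m \<noteq> 0"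
  proof
    assume "m = 0"
    then have "\<forall>i<k. c0 i = 0" using assms unfolding m_def lin_indep_def by simp
    then have "(\<Sum>i<k. \<bar>c0 i\<bar>) = 0" by simp
    then show False using c0(1) unfolding K_def by simp
  qed
  then have "m > 0" unfolding m_def by simp
  moreover have "m * (\<Sum>i<k. \<bar>c i\<bar>) \<le> norm (\<Sum>i<k. c i *\<^sub>R b i)" for c
  proof (cases "(\<Sum>i<k. \<bar>c i\<bar>) = 0")
    case False
    define t where "t = (\<Sum>i<k. \<bar>c i\<bar>)"
    have t: "t > 0" using False unfolding t_def by (simp add: order_less_le sum_nonneg)
    \<comment> \<open>Besides normalising, this cuts off the coefficients beyond \<open>k\<close>,
      which are arbitrary in \<open>c\<close> but must lie in the cube.\<close>
    define d where "d i = (if i < k then c i / t else 0)" for i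
    have "\<bar>c i\<bar> \<le> t" if "i < k" for i
      unfolding t_def using that by (intro member_le_sum) auto
    then have "d i \<in> {-1..1}" for i
      using t unfolding d_def by (auto simp: divide_simps abs_le_iff minus_le_iff)
    moreover have "(\<Sum>i<k. \<bar>d i\<bar>) = 1"
      using t unfolding d_def by (simp add: abs_divide flip: sum_divide_distrib) (simp add: t_def)
    ultimately have "d \<in> K" unfolding K_def by auto
    then have "m \<le> norm (\<Sum>i<k. d i *\<^sub>R b i)" using c0(2) unfolding m_def by blast
    also have "(\<Sum>i<k. d i *\<^sub>R b i) = (1/t) *\<^sub>R (\<Sum>i<k. c i *\<^sub>R b i)"
      unfolding d_def by (simp add: scaleR_sum_right)
    finally show ?thesis using t by (simp add: field_simps flip: t_def)
  qed simp
  ultimately show thesis by (rule that)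
qed

text \<open>With \<open>m\<close> from \<open>lin_indep_lower_bound\<close>, moving each vector by
  less than \<open>m / 2\<close> changes a combination by at most half of its lower bound, so no
  nontrivial combination can vanish.\<close>

lemma lin_indep_open:
  fixes b :: "nat \<Rightarrow> 'v::real_normed_vector"
  assumes "lin_indep k b"
  obtains e where "e > 0" "\<And>s. (\<And>i. i < k \<Longrightarrow> norm (s i - b i) < e) \<Longrightarrow> lin_indep k s"
proof -
  obtain m where m: "m > 0" "\<And>c. m * (\<Sum>i<k. \<bar>c i\<bar>) \<le> norm (\<Sum>i<k. c i *\<^sub>R b i)"
    using lin_indep_lower_bound[OF assms] by blast
  have "lin_indep k s" if s: "\<And>i. i < k \<Longrightarrow> norm (s i - b i) < m / 2" for s
    unfolding lin_indep_def
  proof (intro allI impI)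
    fix c i assume 0: "(\<Sum>i<k. c i *\<^sub>R s i) = 0" and i: "i < k"
    have "(\<Sum>i<k. c i *\<^sub>R b i) = - (\<Sum>i<k. c i *\<^sub>R (s i - b i))"
      using 0 by (simp add: scaleR_diff_right sum_subtractf)
    then have "norm (\<Sum>i<k. c i *\<^sub>R b i) \<le> (\<Sum>i<k. norm (c i *\<^sub>R (s i - b i)))"
      by (simp only: norm_minus_cancel) (rule norm_sum)
    also have "\<dots> \<le> (\<Sum>i<k. \<bar>c i\<bar> * (m / 2))"
      unfolding norm_scaleR by (intro sum_mono mult_left_mono less_imp_le[OF s]) auto
    also have "\<dots> = m / 2 * (\<Sum>i<k. \<bar>c i\<bar>)" by (simp add: sum_distrib_left mult.commute)
    finally have "m / 2 * (\<Sum>i<k. \<bar>c i\<bar>) \<le> 0" using m(2)[of c] by simp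
    then have "(\<Sum>i<k. \<bar>c i\<bar>) \<le> 0" using m(1) by (simp add: mult_le_0_iff)
    then have "(\<Sum>i<k. \<bar>c i\<bar>) = 0" by (intro antisym) (auto intro: sum_nonneg)
    then show "c i = 0" using i by (simp add: sum_nonneg_eq_0_iff)
  qed
  then show thesis using m(1) by (intro that[of "m/2"]) auto
qed

lemma vbundle_frame:
  "vbundle \<Lambda> E \<longleftrightarrow> (\<forall>l\<in>\<Lambda>. subspace (E l)) \<and>
     (\<forall>l0\<in>\<Lambda>. \<exists>U k s. openin (top_of_set \<Lambda>) U \<and> l0 \<in> U \<and>
        (\<forall>i<k. continuous_on U (s i)) \<and> (\<forall>l\<in>U. frame k (\<lambda>i. s i l) (E l)))"
  unfolding vbundle_def frame_iff_basis by blast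

lemma vbundleE:
  assumes "vbundle \<Lambda> E" "l0 \<in> \<Lambda>"
  obtains U k s where "openin (top_of_set \<Lambda>) U" "l0 \<in> U" "\<And>i. i < k \<Longrightarrow> continuous_on U (s i)"
    "\<And>l. l \<in> U \<Longrightarrow> frame k (\<lambda>i. s i l) (E l)"
proof -
  have "\<exists>U k s. openin (top_of_set \<Lambda>) U \<and> l0 \<in> U \<and>
        (\<forall>i<k. continuous_on U (s i)) \<and> (\<forall>l\<in>U. frame k (\<lambda>i. s i l) (E l))"
    using assms unfolding vbundle_frame by (elim conjE) (rule bspec)
  then obtain U k s where "openin (top_of_set \<Lambda>) U \<and> l0 \<in> U \<and>
        (\<forall>i<k. continuous_on U (s i)) \<and> (\<forall>l\<in>U. frame k (\<lambda>i. s i l) (E l))"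
    by (elim exE)
  then show thesis by (intro that[of U k s]) auto
qed

lemma bundle_isoE:
  assumes "bundle_iso \<Lambda> E F"
  obtains \<phi> \<psi> where
    "\<And>l u v. l \<in> \<Lambda> \<Longrightarrow> u \<in> E l \<Longrightarrow> v \<in> E l \<Longrightarrow> \<phi> l (u + v) = \<phi> l u + \<phi> l v"
    "\<And>l c u. l \<in> \<Lambda> \<Longrightarrow> u \<in> E l \<Longrightarrow> \<phi> l (c *\<^sub>R u) = c *\<^sub>R \<phi> l u"
    "\<And>l u. l \<in> \<Lambda> \<Longrightarrow> u \<in> E l \<Longrightarrow> \<phi> l u \<in> F l \<and> \<psi> l (\<phi> l u) = u"
    "\<And>l w. l \<in> \<Lambda> \<Longrightarrow> w \<in> F l \<Longrightarrow> \<psi> l w \<in> E l \<and> \<phi> l (\<psi> l w) = w"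
    "continuous_on (SIGMA l:\<Lambda>. E l) (\<lambda>(l, u). \<phi> l u)"
    "continuous_on (SIGMA l:\<Lambda>. F l) (\<lambda>(l, w). \<psi> l w)"
  using assms unfolding bundle_iso_def
proof (elim exE conjE, goal_cases)
  case (1 \<phi> \<psi>)
  then show ?case by (intro that[of \<phi> \<psi>]) auto
qed

lemma vbundle_const:
  assumes "fin_dim_subspace V"
  shows "vbundle \<Lambda> (\<lambda>_. V)"
proof -
  obtain B where B: "finite B" "V = span B" using assms unfolding fin_dim_subspace_def by blast
  then obtain k s where "frame k s V" using frame_exists[of V B] subspace_span by blast
  then show ?thesis
    unfolding vbundle_frame using B
    by (auto intro!: exI[of _ \<Lambda>] exI[of _ k] exI[of _ "\<lambda>i _. s i"])
qed

lemma vbundle_bsum: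
  assumes "vbundle \<Lambda> E" "vbundle \<Lambda> F"
  shows "vbundle \<Lambda> (bsum E F)"
  unfolding vbundle_frame
proof (intro conjI ballI)
  fix l assume "l \<in> \<Lambda>"
  then show "subspace (bsum E F l)"
    using assms unfolding bsum_def vbundle_def by (auto intro: subspace_Times)
next
  fix l0 assume l0: "l0 \<in> \<Lambda>"
  obtain U k s where U: "openin (top_of_set \<Lambda>) U" "l0 \<in> U" "\<And>i. i < k \<Longrightarrow> continuous_on U (s i)"
    "\<And>l. l \<in> U \<Longrightarrow> frame k (\<lambda>i. s i l) (E l)"
    by (rule vbundleE[OF assms(1) l0]) (rule that)
  obtain V m t where V: "openin (top_of_set \<Lambda>) V" "l0 \<in> V" "\<And>i. i < m \<Longrightarrow> continuous_on V (t i)"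
    "\<And>l. l \<in> V \<Longrightarrow> frame m (\<lambda>i. t i l) (F l)"
    by (rule vbundleE[OF assms(2) l0]) (rule that)
  let ?r = "\<lambda>i l. if i < k then (s i l, 0) else (0, t (i - k) l)"
  have "continuous_on (U \<inter> V) (?r i)" if "i < k + m" for i
    using that continuous_on_subset[OF U(3)[of i], of "U \<inter> V"]
      continuous_on_subset[OF V(3)[of "i - k"], of "U \<inter> V"]
    by (cases "i < k") (auto intro!: continuous_intros)
  moreover have "frame (k + m) (\<lambda>i. ?r i l) (bsum E F l)" if "l \<in> U \<inter> V" for l
    using frame_Times[OF U(4) V(4)] that unfolding bsum_def by blast
  ultimately show "\<exists>U k s. openin (top_of_set \<Lambda>) U \<and> l0 \<in> U \<and>
        (\<forall>i<k. continuous_on U (s i)) \<and> (\<forall>l\<in>U. frame k (\<lambda>i. s i l) (bsum E F l))"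
    using U V by (intro exI[of _ "U \<inter> V"] exI[of _ "k + m"] exI[of _ ?r]) (auto intro: openin_Int)
qed

text \<open>\<open>bundle_iso\<close> asks for linearity of the forward map only; that of the
  inverse follows by writing its arguments as images under \<open>\<phi>\<close>.\<close>

lemma bundle_iso_linear_inverse:
  assumes V: "subspace V"
    and add: "\<And>u v. u \<in> V \<Longrightarrow> v \<in> V \<Longrightarrow> \<phi> (u + v) = \<phi> u + \<phi> v"
    and scale: "\<And>c u. u \<in> V \<Longrightarrow> \<phi> (c *\<^sub>R u) = c *\<^sub>R \<phi> u"
    and 1: "\<And>u. u \<in> V \<Longrightarrow> \<phi> u \<in> W \<and> \<psi> (\<phi> u) = u"
    and 2: "\<And>w. w \<in> W \<Longrightarrow> \<psi> w \<in> V \<and> \<phi> (\<psi> w) = w"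
  shows "\<And>u v. u \<in> W \<Longrightarrow> v \<in> W \<Longrightarrow> \<psi> (u + v) = \<psi> u + \<psi> v"
    and "\<And>c u. u \<in> W \<Longrightarrow> \<psi> (c *\<^sub>R u) = c *\<^sub>R \<psi> u"
    and "bij_betw \<psi> W V"
proof -
  fix u v c assume u: "u \<in> W"
  have "\<psi> (c *\<^sub>R u) = \<psi> (\<phi> (c *\<^sub>R \<psi> u))" by (simp add: u 2 scale)
  then show "\<psi> (c *\<^sub>R u) = c *\<^sub>R \<psi> u" by (simp add: 1 2 u V subspace_scale)
  assume v: "v \<in> W"
  have "\<psi> (u + v) = \<psi> (\<phi> (\<psi> u + \<psi> v))" by (simp add: u v 2 add)
  then show "\<psi> (u + v) = \<psi> u + \<psi> v" by (simp add: 1 2 u v V subspace_add)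
next
  show "bij_betw \<psi> W V" using 1 2 by (intro bij_betw_byWitness[of _ \<phi>]) auto
qed

text \<open>Ranks of \<open>N\<close> are locally constant by counting dimensions, so a basis of one fibre of \<open>N\<close>,
  extended to sections of \<open>N\<close> through the isomorphism, stays a basis nearby.\<close>
lemma vbundle_summand:
  fixes N :: "'a::metric_space \<Rightarrow> 'v::real_normed_vector set"
    and F :: "'a \<Rightarrow> 'w::real_normed_vector set" and B :: "'a \<Rightarrow> 'b::real_normed_vector set"
  assumes iso: "bundle_iso \<Lambda> (bsum N F) B" and F: "vbundle \<Lambda> F" and B: "vbundle \<Lambda> B"
    and N: "\<And>l. l \<in> \<Lambda> \<Longrightarrow> subspace (N l)"
  shows "vbundle \<Lambda> N"
  unfolding vbundle_frame
proof (intro conjI ballI)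
  fix l0 assume l0: "l0 \<in> \<Lambda>"
  obtain \<phi> :: "'a \<Rightarrow> 'v \<times> 'w \<Rightarrow> 'b" and \<psi> where
    add: "\<And>l u v. l \<in> \<Lambda> \<Longrightarrow> u \<in> N l \<times> F l \<Longrightarrow> v \<in> N l \<times> F l \<Longrightarrow> \<phi> l (u + v) = \<phi> l u + \<phi> l v" and
    scale: "\<And>l c u. l \<in> \<Lambda> \<Longrightarrow> u \<in> N l \<times> F l \<Longrightarrow> \<phi> l (c *\<^sub>R u) = c *\<^sub>R \<phi> l u" and
    inv1: "\<And>l u. l \<in> \<Lambda> \<Longrightarrow> u \<in> N l \<times> F l \<Longrightarrow> \<phi> l u \<in> B l \<and> \<psi> l (\<phi> l u) = u" and
    inv2: "\<And>l w. l \<in> \<Lambda> \<Longrightarrow> w \<in> B l \<Longrightarrow> \<psi> l w \<in> N l \<times> F l \<and> \<phi> l (\<psi> l w) = w" and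
    cont: "continuous_on (SIGMA l:\<Lambda>. B l) (\<lambda>(l, w). \<psi> l w)"
    by (rule bundle_isoE[OF iso[unfolded bsum_def]]) (rule that)
  obtain U k f where U: "openin (top_of_set \<Lambda>) U" "l0 \<in> U" "\<And>l. l \<in> U \<Longrightarrow> frame k (\<lambda>i. f i l) (F l)"
    by (rule vbundleE[OF F l0]) (rule that)
  obtain V m \<beta> where V: "openin (top_of_set \<Lambda>) V" "l0 \<in> V" "\<And>i. i < m \<Longrightarrow> continuous_on V (\<beta> i)"
    "\<And>l. l \<in> V \<Longrightarrow> frame m (\<lambda>i. \<beta> i l) (B l)"
    by (rule vbundleE[OF B l0]) (rule that)
  have sub: "U \<subseteq> \<Lambda>" "V \<subseteq> \<Lambda>" using U(1) V(1) by (auto dest: openin_imp_subset)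
  have fr: "\<exists>b. frame (m - k) b (N l)" if l: "l \<in> U \<inter> V" for l
  proof -
    have l\<Lambda>: "l \<in> \<Lambda>" using l sub by blast
    have sF: "subspace (F l)" using F l\<Lambda> unfolding vbundle_def by blast
    have sNF: "subspace (N l \<times> F l)" using N[OF l\<Lambda>] sF by (rule subspace_Times)
    note \<psi> = bundle_iso_linear_inverse[OF sNF add[OF l\<Lambda>] scale[OF l\<Lambda>] inv1[OF l\<Lambda>] inv2[OF l\<Lambda>]]
    have P: "frame m (\<lambda>i. \<psi> l (\<beta> i l)) (N l \<times> F l)"
      using l by (intro frame_transfer[OF V(4)] \<psi>) auto
    \<comment> \<open>The ambient space may be infinite-dimensional; projecting a frame of the
      product shows that \<open>N l\<close> has a finite basis at all, so that dimensions may be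
      counted.\<close>
    have "N l \<subseteq> span (fst ` (\<lambda>i. \<psi> l (\<beta> i l)) ` {..<m})"
    proof
      fix u assume "u \<in> N l"
      then have "(u, 0) \<in> span ((\<lambda>i. \<psi> l (\<beta> i l)) ` {..<m})"
        using P subspace_0[OF sF] unfolding frame_iff_basis by simp
      then have "fst (u, 0::'w) \<in> fst ` span ((\<lambda>i. \<psi> l (\<beta> i l)) ` {..<m})" by (rule imageI)
      then show "u \<in> span (fst ` (\<lambda>i. \<psi> l (\<beta> i l)) ` {..<m})"
        by (simp add: linear_span_image[OF linear_fst])
    qed
    then obtain n b where b: "frame n b (N l)"
      using frame_exists[OF N[OF l\<Lambda>]] by (metis finite_imageI finite_lessThan)
    then have "dim (N l \<times> F l) = n + k" using frame_dim[OF frame_Times[OF b U(3)]] l by blast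
    then have "n = m - k" using frame_dim[OF P] by simp
    then show ?thesis using b by blast
  qed
  define n where "n = m - k"
  obtain b where b: "frame n b (N l0)" using fr[of l0] U V unfolding n_def by blast
  have bN: "b j \<in> N l0" if "j < n" for j
    using b that unfolding frame_iff_basis by (metis imageI lessThan_iff span_base)
  have F0: "0 \<in> F l0" using F l0 subspace_0 unfolding vbundle_def by blast
  have "\<exists>c. \<phi> l0 (b j, 0) = (\<Sum>i<m. c i *\<^sub>R \<beta> i l0)" if "j < n" for j
  proof -
    have "\<phi> l0 (b j, 0) \<in> B l0" using inv1[OF l0, of "(b j, 0)"] bN[OF that] F0 by auto
    then show ?thesis using V(4)[OF V(2)] unfolding frame_def by auto
  qed
  then obtain c where c: "\<And>j. j < n \<Longrightarrow> \<phi> l0 (b j, 0) = (\<Sum>i<m. c j i *\<^sub>R \<beta> i l0)" by metis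
  \<comment> \<open>The coordinates of the basis of \<open>N l0\<close>, taken in the frame
    \<open>\<beta>\<close> at \<open>l0\<close>, are frozen and reused at nearby points. Pulling
    back by \<open>\<psi>\<close> may create an \<open>F\<close>-component away from
    \<open>l0\<close>; \<open>fst\<close> discards it in \<open>s\<close>.\<close>
  define \<sigma> where "\<sigma> j l = (\<Sum>i<m. c j i *\<^sub>R \<beta> i l)" for j l
  define s where "s j l = fst (\<psi> l (\<sigma> j l))" for j l
  have \<sigma>B: "\<sigma> j l \<in> B l" if "l \<in> V" for j l
    using V(4)[OF that] unfolding frame_def \<sigma>_def by blast
  have s0: "s j l0 = b j" if "j < n" for j
    using inv1[OF l0, of "(b j, 0)"] bN[OF that] F0 c[OF that] unfolding s_def \<sigma>_def by simp
  have sN: "s j l \<in> N l" if "l \<in> V" for j l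
    using inv2[of l "\<sigma> j l"] \<sigma>B[OF that] sub that unfolding s_def by (auto simp: mem_Times_iff)
  have cs: "continuous_on V (s j)" for j
  proof -
    have "continuous_on V (\<sigma> j)" unfolding \<sigma>_def using V(3) by (intro continuous_intros) auto
    then have "continuous_on V (\<lambda>l. (\<lambda>(l, w). \<psi> l w) (l, \<sigma> j l))"
      using sub \<sigma>B by (intro continuous_on_compose2[OF cont] continuous_intros) auto
    then show ?thesis unfolding s_def by (auto intro!: continuous_intros)
  qed
  obtain e where e: "e > 0" "\<And>t. (\<And>i. i < n \<Longrightarrow> norm (t i - b i) < e) \<Longrightarrow> lin_indep n t"
    using lin_indep_open b unfolding frame_def by metis
  \<comment> \<open>A single scalar function controls all \<open>n\<close> sections at once;
    \<open>e\<close> is the tolerance of \<open>lin_indep_open\<close>.\<close>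
  define W where "W = (U \<inter> V) \<inter> ((\<lambda>l. \<Sum>j<n. norm (s j l - b j)) -` {..<e})"
  have "openin (top_of_set (U \<inter> V)) W"
    unfolding W_def
    by (intro continuous_openin_preimage_gen continuous_intros continuous_on_subset[OF cs]) auto
  then have "openin (top_of_set \<Lambda>) W"
    using openin_trans openin_Int U(1) V(1) by blast
  moreover have "l0 \<in> W" using U V s0 e(1) unfolding W_def by simp
  moreover have "continuous_on W (s j)" for j
    by (rule continuous_on_subset[OF cs]) (auto simp: W_def)
  moreover have "frame n (\<lambda>j. s j l) (N l)" if l: "l \<in> W" for l
  proof -
    have "norm (s i l - b i) < e" if "i < n" for i
    proof -
      have "norm (s i l - b i) \<le> (\<Sum>j<n. norm (s j l - b j))"
        using that by (intro member_le_sum[of i _ "\<lambda>j. norm (s j l - b j)"]) auto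
      then show ?thesis using l unfolding W_def by auto
    qed
    then have ind: "lin_indep n (\<lambda>j. s j l)" by (rule e(2))
    obtain b' where b': "frame n b' (N l)" using fr l unfolding W_def n_def by blast
    show ?thesis using sN l by (intro frame_of_indep[OF b' ind]) (auto simp: W_def)
  qed
  ultimately show "\<exists>U k s. openin (top_of_set \<Lambda>) U \<and> l0 \<in> U \<and>
        (\<forall>i<k. continuous_on U (s i)) \<and> (\<forall>l\<in>U. frame k (\<lambda>i. s i l) (N l))"
    by (intro exI[of _ W] exI[of _ n] exI[of _ s]) auto
qed (use N in auto)

subsection \<open>Orthogonal projections onto a bundle\<close>

lemma norm_matrix_vector_le: "norm (A *v x) \<le> norm A * norm x" for A :: "real^'n^'m"
proof -
  have "norm (A *v x) = L2_set (\<lambda>i. norm ((A *v x) $ i)) UNIV" by (rule norm_vec_def)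
  also have "\<dots> \<le> L2_set (\<lambda>i. norm (A $ i) * norm x) UNIV"
    by (intro L2_set_mono) (auto simp: matrix_vector_mul_component Cauchy_Schwarz_ineq2)
  also have "\<dots> = norm A * norm x" by (simp add: L2_set_left_distrib norm_vec_def)
  finally show ?thesis .
qed

lemma continuous_on_matrix_vector_mult:
  fixes A :: "'a::topological_space \<Rightarrow> real^'n^'m"
  assumes "continuous_on S A" "continuous_on S x"
  shows "continuous_on S (\<lambda>l. A l *v x l)"
  unfolding matrix_vector_mult_def
  by (intro continuous_on_vec_lambda continuous_intros assms)

lemma continuous_on_matrix_mult:
  fixes A :: "'a::topological_space \<Rightarrow> real^'n^'m" and B :: "'a \<Rightarrow> real^'p^'n"
  assumes "continuous_on S A" "continuous_on S B"
  shows "continuous_on S (\<lambda>l. A l ** B l)"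
  unfolding matrix_matrix_mult_def
  by (intro continuous_on_vec_lambda continuous_intros assms)

lemma invertible_mult_inv: "invertible M \<Longrightarrow> M *v (matrix_inv M *v x) = x" for M :: "real^'n^'n"
  unfolding invertible_def matrix_inv_def
  by (rule someI2_ex) (auto simp: matrix_vector_mul_assoc)

text \<open>Cramer's rule writes each coordinate as a quotient of determinants, which are
  polynomials in the entries.\<close>

lemma continuous_on_matrix_inv_mult:
  fixes M :: "'a::topological_space \<Rightarrow> real^'n^'n"
  assumes M: "continuous_on S M" and x: "continuous_on S x"
    and inv: "\<And>l. l \<in> S \<Longrightarrow> invertible (M l)"
  shows "continuous_on S (\<lambda>l. matrix_inv (M l) *v x l)"
proof -
  have det: "det (M l) \<noteq> 0" if "l \<in> S" for l
    using inv[OF that] by (simp add: invertible_det_nz)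
  have "matrix_inv (M l) *v x l =
      (\<chi> k. det (\<chi> i j. if j = k then x l $ i else M l $ i $ j) / det (M l))" if "l \<in> S" for l
    using cramer[OF det[OF that]] invertible_mult_inv[OF inv[OF that]] by blast
  moreover have "continuous_on S (\<lambda>l. \<chi> k. det (\<chi> i j. if j = k then x l $ i else M l $ i $ j) / det (M l))"
    unfolding det_def
  proof (intro continuous_on_vec_lambda continuous_on_divide continuous_on_sum continuous_on_mult
      continuous_on_const continuous_on_prod ballI)
    fix k i :: 'n and p
    show "continuous_on S (\<lambda>l. (\<chi> i j. if j = k then x l $ i else M l $ i $ j) $ i $ p i)"
      by (cases "p i = k") (auto intro!: continuous_intros M x)
  qed (use det in \<open>auto simp: det_def intro!: continuous_intros M\<close>)
  ultimately show ?thesis by (simp cong: continuous_on_cong)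
qed

definition orth_proj :: "real^'n^'n \<Rightarrow> (real^'n) set \<Rightarrow> bool" where
  "orth_proj p W \<longleftrightarrow> subspace W \<and> (\<forall>x. p *v x \<in> W \<and> (\<forall>w\<in>W. (x - p *v x) \<bullet> w = 0))"

context
  fixes p :: "real^'n^'n" and W
  assumes p: "orth_proj p W"
begin

lemma orth_proj_subspace: "subspace W" using p unfolding orth_proj_def by blast

lemma orth_proj_in: "p *v x \<in> W" using p unfolding orth_proj_def by blast

lemma orth_proj_inner: "w \<in> W \<Longrightarrow> (p *v x) \<bullet> w = x \<bullet> w"
  using p unfolding orth_proj_def by (metis eq_iff_diff_eq_0 inner_diff_left)

lemma orth_proj_eqI: "y \<in> W \<Longrightarrow> (\<And>w. w \<in> W \<Longrightarrow> (x - y) \<bullet> w = 0) \<Longrightarrow> p *v x = y"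
proof -
  assume y: "y \<in> W" and orth: "\<And>w. w \<in> W \<Longrightarrow> (x - y) \<bullet> w = 0"
  have W: "p *v x - y \<in> W" using orth_proj_in y orth_proj_subspace by (simp add: subspace_diff)
  have "(p *v x - y) \<bullet> (p *v x - y) = 0"
    using orth[OF W] orth_proj_inner[OF W, of x] by (simp add: inner_diff_left)
  then show ?thesis by simp
qed

lemma orth_proj_id: "x \<in> W \<Longrightarrow> p *v x = x"
  by (rule orth_proj_eqI) auto

lemma orth_proj_in_iff: "x \<in> W \<longleftrightarrow> p *v x = x"
  using orth_proj_id orth_proj_in by metis

lemma orth_proj_idem: "p *v (p *v x) = p *v x"
  by (rule orth_proj_id[OF orth_proj_in])

lemma orth_proj_sym: "(p *v x) \<bullet> y = x \<bullet> (p *v y)"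
  using orth_proj_inner[OF orth_proj_in, of x y] orth_proj_inner[OF orth_proj_in, of y x]
  by (simp add: inner_commute)

text \<open>Pythagoras. The constant 1 matters: it lets the factors \<open>1/4\<close> pass through
  the projections in \<open>step_bound\<close> without loss.\<close>

lemma orth_proj_norm: "norm (p *v x) \<le> norm x" "norm (x - p *v x) \<le> norm x"
proof -
  have "(p *v x) \<bullet> (x - p *v x) = 0"
    using orth_proj_inner[OF orth_proj_in, of x x] by (simp add: inner_diff_right inner_commute)
  then have "(norm x)\<^sup>2 = (norm (p *v x))\<^sup>2 + (norm (x - p *v x))\<^sup>2"
    using norm_add_Pythagorean[of "p *v x" "x - p *v x"] by (simp add: orthogonal_def)
  then show "norm (p *v x) \<le> norm x" "norm (x - p *v x) \<le> norm x"
    by (simp_all add: power2_le_imp_le)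
qed

end

lemma orth_proj_unique:
  assumes "orth_proj p W" "orth_proj q W"
  shows "p = q"
  unfolding matrix_eq
  by (intro allI orth_proj_eqI[OF assms(1)]) (use assms(2) in \<open>auto simp: orth_proj_def\<close>)

text \<open>Gram--Schmidt, performed on the projections instead of the vectors.\<close>
lemma orth_proj_span_continuous:
  fixes s :: "nat \<Rightarrow> 'a::topological_space \<Rightarrow> real^'n"
  assumes "\<And>i. i < k \<Longrightarrow> continuous_on U (s i)" and "\<And>l. l \<in> U \<Longrightarrow> lin_indep k (\<lambda>i. s i l)"
  shows "\<exists>P. continuous_on U P \<and> (\<forall>l\<in>U. orth_proj (P l) (span ((\<lambda>i. s i l) ` {..<k})))"
  using assms
proof (induction k)
  case 0
  show ?case
    by (intro exI[of _ "\<lambda>_. 0"]) (auto simp: orth_proj_def)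
next
  case (Suc k)
  have ind: "lin_indep k (\<lambda>i. s i l)" and nin: "s k l \<notin> span ((\<lambda>i. s i l) ` {..<k})" if l: "l \<in> U" for l
  proof -
    let ?t = "\<lambda>i. s i l"
    have 1: "inj_on ?t (insert k {..<k})" "independent (insert (?t k) (?t ` {..<k}))"
      using Suc.prems(2)[OF l] unfolding lin_indep_iff_independent lessThan_Suc by auto
    then show "lin_indep k (\<lambda>i. s i l)"
      unfolding lin_indep_iff_independent
      using independent_mono[OF 1(2) subset_insertI] by auto
    have "?t k \<notin> ?t ` {..<k}" using 1(1) by auto
    then show "?t k \<notin> span (?t ` {..<k})" using 1(2) by (simp add: independent_insert)
  qed
  then obtain P where P: "continuous_on U P"
    "\<And>l. l \<in> U \<Longrightarrow> orth_proj (P l) (span ((\<lambda>i. s i l) ` {..<k}))"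
    using Suc.IH Suc.prems(1) by (auto simp: less_Suc_eq)
  define w where "w l = s k l - P l *v s k l" for l
  \<comment> \<open>The rank-one projection \<open>w w^T / |w|^2\<close> onto the line spanned by
    the component of \<open>s k l\<close> orthogonal to the earlier sections.\<close>
  define R where "R l = (\<chi> i j. w l $ i * w l $ j / (w l \<bullet> w l))" for l
  have Rx: "R l *v x = ((w l \<bullet> x) / (w l \<bullet> w l)) *\<^sub>R w l" for l x
    unfolding R_def matrix_vector_mult_def
    by (simp add: vec_eq_iff inner_vec_def sum_distrib_left sum_divide_distrib mult_ac)
  have w: "w l \<noteq> 0" if "l \<in> U" for l
    using nin[OF that] orth_proj_in[OF P(2)[OF that], of "s k l"] unfolding w_def by auto
  have cw: "continuous_on U w"
    unfolding w_def using Suc.prems(1)[of k]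
    by (intro continuous_intros continuous_on_matrix_vector_mult P(1)) auto
  have "continuous_on U R"
    unfolding R_def using w by (intro continuous_on_vec_lambda continuous_intros cw) auto
  then have "continuous_on U (\<lambda>l. P l + R l)" by (intro continuous_intros P(1))
  moreover have "orth_proj (P l + R l) (span ((\<lambda>i. s i l) ` {..<Suc k}))" if l: "l \<in> U" for l
  proof -
    let ?S = "span ((\<lambda>i. s i l) ` {..<k})" and ?S' = "span ((\<lambda>i. s i l) ` {..<Suc k})"
    have sub: "?S \<subseteq> ?S'" by (intro span_mono) auto
    have PS: "P l *v x \<in> ?S" for x by (rule orth_proj_in[OF P(2)[OF l]])
    have sk: "s k l \<in> ?S'" by (intro span_base) auto
    have wS: "w l \<in> ?S'" unfolding w_def using sub PS sk by (intro span_diff) auto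
    have worth: "w l \<bullet> v = 0" if "v \<in> ?S" for v
      using orth_proj_inner[OF P(2)[OF l] that, of "s k l"] unfolding w_def by (simp add: inner_diff_left)
    define z where "z x = x - (P l *v x + R l *v x)" for x
    have zS: "z x \<bullet> v = 0" if "v \<in> ?S" for x v
      using orth_proj_inner[OF P(2)[OF l] that, of x] worth[OF that]
      unfolding z_def Rx by (simp add: inner_diff_left inner_add_left)
    have zw: "z x \<bullet> w l = 0" for x
      using w[OF l] worth[OF PS, of x] unfolding z_def Rx
      by (simp add: inner_diff_left inner_add_left inner_commute[of "P l *v x"] inner_commute[of x])
    have "z x \<bullet> s k l = 0" for x
    proof -
      have "s k l = w l + P l *v s k l" unfolding w_def by simp
      then have "z x \<bullet> s k l = z x \<bullet> w l + z x \<bullet> (P l *v s k l)" by (simp flip: inner_add_right)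
      then show ?thesis using zw zS[OF PS] by simp
    qed
    then have "\<forall>v\<in>(\<lambda>i. s i l) ` {..<Suc k}. z x \<bullet> v = 0" for x
      using zS span_superset[of "(\<lambda>i. s i l) ` {..<k}"] by (auto simp: lessThan_Suc)
    then have "?S' \<subseteq> {v. z x \<bullet> v = 0}" for x
      by (intro span_minimal) (auto simp: subspace_hyperplane)
    then have "z x \<bullet> v = 0" if "v \<in> ?S'" for x v using that by blast
    moreover have "P l *v x + R l *v x \<in> ?S'" for x
      unfolding Rx using sub PS wS by (intro span_add span_scale) auto
    ultimately show ?thesis
      unfolding orth_proj_def by (auto simp: matrix_vector_mult_add_rdistrib z_def)
  qed
  ultimately show ?case by blast
qed

text \<open>The local continuous families depend on chosen frames, but the projections they compute
  do not. By \<open>orth_proj_unique\<close> they agree with one global choice, which is therefore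
  continuous.\<close>

lemma vbundle_orth_proj:
  fixes E :: "'a::metric_space \<Rightarrow> (real^'n) set"
  assumes "vbundle \<Lambda> E"
  obtains P where "continuous_on \<Lambda> P" "\<And>l. l \<in> \<Lambda> \<Longrightarrow> orth_proj (P l) (E l)"
proof -
  have loc: "\<exists>U P. openin (top_of_set \<Lambda>) U \<and> l0 \<in> U \<and> continuous_on U P \<and> (\<forall>l\<in>U. orth_proj (P l) (E l))"
    if l0: "l0 \<in> \<Lambda>" for l0
  proof -
    obtain U k s where U: "openin (top_of_set \<Lambda>) U" "l0 \<in> U" "\<And>i. i < k \<Longrightarrow> continuous_on U (s i)"
      "\<And>l. l \<in> U \<Longrightarrow> frame k (\<lambda>i. s i l) (E l)"
      by (rule vbundleE[OF assms l0]) (rule that)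
    then have "\<exists>P. continuous_on U P \<and> (\<forall>l\<in>U. orth_proj (P l) (span ((\<lambda>i. s i l) ` {..<k})))"
      by (intro orth_proj_span_continuous) (auto simp: frame_def)
    moreover have "span ((\<lambda>i. s i l) ` {..<k}) = E l" if "l \<in> U" for l
      using U(4)[OF that] unfolding frame_iff_basis by blast
    ultimately show ?thesis using U(1,2) by auto
  qed
  define P where "P l = (SOME p. orth_proj p (E l))" for l
  have P: "orth_proj (P l) (E l)" if "l \<in> \<Lambda>" for l
  proof -
    have "\<exists>p. orth_proj p (E l)" using loc[OF that] by blast
    then show ?thesis unfolding P_def by (rule someI_ex)
  qed
  have "continuous_on \<Lambda> P"
    unfolding continuous_on_def
  proof
    fix l0 assume l0: "l0 \<in> \<Lambda>"
    obtain U P' where U: "openin (top_of_set \<Lambda>) U" "l0 \<in> U" "continuous_on U P'"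
      "\<And>l. l \<in> U \<Longrightarrow> orth_proj (P' l) (E l)"
      using loc[OF l0] by blast
    have "P l = P' l" if "l \<in> U" for l
      using orth_proj_unique[OF P U(4)] that U(1) openin_imp_subset by blast
    then have "continuous_on U P" using U(3) by (simp cong: continuous_on_cong)
    then have "(P \<longlongrightarrow> P l0) (at l0 within U)" using U(2) unfolding continuous_on_def by blast
    moreover obtain T where "open T" "U = \<Lambda> \<inter> T" using U(1) by (auto simp: openin_open)
    moreover have "at l0 within U = at l0 within \<Lambda>"
      using \<open>open T\<close> \<open>U = \<Lambda> \<inter> T\<close> U(2) by (intro at_within_nhd[of _ T]) auto
    ultimately show "(P \<longlongrightarrow> P l0) (at l0 within \<Lambda>)" by simp
  qed
  then show thesis using P by (rule that)
qed

subsection \<open>Null sequences on the integers\<close>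

text \<open>A single limit along the join of the two filters, so that each limit rule is applied
  once for both ends.\<close>

lemma mem_ell0: "f \<in> ell0 \<longleftrightarrow> (apply_bcontfun f \<longlongrightarrow> 0) (sup at_top at_bot)"
  unfolding ell0_def tendsto_def eventually_sup by auto

lemma null_imp_bcontfun:
  fixes f :: "int \<Rightarrow> 'v::real_normed_vector"
  assumes "(f \<longlongrightarrow> 0) (sup at_top at_bot)"
  shows "f \<in> bcontfun"
proof -
  have "eventually (\<lambda>n. norm (f n) < 1) (sup at_top at_bot)"
    using tendstoD[OF assms, of 1] by (simp add: dist_norm)
  then obtain N M where NM: "\<And>n. N \<le> n \<Longrightarrow> norm (f n) < 1" "\<And>n. n \<le> M \<Longrightarrow> norm (f n) < 1"
    unfolding eventually_sup eventually_at_top_linorder eventually_at_bot_linorder by blast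
  have "range f \<subseteq> ball 0 1 \<union> f ` {M..N}"
  proof clarify
    fix n assume "f n \<notin> f ` {M..N}"
    then have "\<not> (M \<le> n \<and> n \<le> N)" by auto
    then show "f n \<in> ball 0 1" using NM[of n] by (auto simp: not_le)
  qed
  then have "bounded (range f)"
    by (rule bounded_subset[rotated]) (simp add: finite_imp_bounded)
  \<comment> \<open>Continuity is automatic because \<open>int\<close> is discrete.\<close>
  then show ?thesis unfolding bcontfun_def by simp
qed

lemma null_imp_ell0:
  fixes f :: "int \<Rightarrow> real^'d"
  assumes "(f \<longlongrightarrow> 0) (sup at_top at_bot)"
  shows "Bcontfun f \<in> ell0" "apply_bcontfun (Bcontfun f) = f"
  using null_imp_bcontfun[OF assms] assms by (auto simp: mem_ell0 Bcontfun_inverse)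

lemma null_shift:
  fixes f :: "int \<Rightarrow> 'v::real_normed_vector"
  assumes "(f \<longlongrightarrow> 0) (sup at_top at_bot)"
  shows "((\<lambda>n. f (n + k)) \<longlongrightarrow> 0) (sup at_top at_bot)"
proof -
  have "filterlim (\<lambda>n::int. n + k) (sup at_top at_bot) (sup at_top at_bot)"
    unfolding filterlim_iff eventually_sup eventually_at_top_linorder eventually_at_bot_linorder
  proof (intro allI impI, elim conjE exE, intro conjI)
    fix P and N M :: int assume "\<forall>n\<ge>N. P n" "\<forall>n\<le>M. P n"
    then show "\<exists>N. \<forall>n\<ge>N. P (n + k)" "\<exists>N. \<forall>n\<le>N. P (n + k)"
      by (intro exI[of _ "N - k"] exI[of _ "M - k"], simp)+
  qed
  from filterlim_compose[OF assms this] show ?thesis .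
qed

text \<open>The bound is tailored to \<open>step\<close> and \<open>Lop\<close>, which see only
  neighbouring entries. The index 0 is exempt because \<open>step\<close> prescribes an arbitrary
  value there.\<close>

lemma null_dominated:
  fixes g :: "int \<Rightarrow> real^'d" and u y :: "int \<Rightarrow>\<^sub>C (real^'d)"
  assumes u: "u \<in> ell0" and y: "y \<in> ell0"
    and le: "\<And>n. n \<noteq> 0 \<Longrightarrow> norm (g n) \<le> C * (norm (u (n - 1)) + norm (u n) + norm (u (n + 1)) + norm (y (n - 1)) + norm (y n))"
  shows "(g \<longlongrightarrow> 0) (sup at_top at_bot)"
proof (rule Lim_null_comparison)
  have "eventually (\<lambda>n::int. n \<noteq> 0) (sup at_top at_bot)"
    unfolding eventually_sup eventually_at_top_linorder eventually_at_bot_linorder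
    by (intro conjI exI[of _ 1] exI[of _ "-1"]) auto
  then show "eventually (\<lambda>n. norm (g n) \<le> C * (norm (u (n - 1)) + norm (u n) + norm (u (n + 1)) + norm (y (n - 1)) + norm (y n))) (sup at_top at_bot)"
    by eventually_elim (rule le)
  have *: "((\<lambda>n. norm (f (n + k))) \<longlongrightarrow> 0) (sup at_top at_bot)" if "f \<in> ell0" for f :: "int \<Rightarrow>\<^sub>C (real^'d)" and k
    using null_shift[of f k] that by (auto simp: mem_ell0 intro: tendsto_norm_zero)
  have "((\<lambda>n. C * (norm (u (n - 1)) + norm (u n) + norm (u (n + 1)) + norm (y (n - 1)) + norm (y n)))
      \<longlongrightarrow> C * (0 + 0 + 0 + 0 + 0)) (sup at_top at_bot)"
    using *[OF u, of "-1"] *[OF u, of 0] *[OF u, of 1] *[OF y, of "-1"] *[OF y, of 0]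
    by (intro tendsto_intros) auto
  then show "((\<lambda>n. C * (norm (u (n - 1)) + norm (u n) + norm (u (n + 1)) + norm (y (n - 1)) + norm (y n)))
      \<longlongrightarrow> 0) (sup at_top at_bot)" by simp
qed

lemma subspace_ell0: "subspace ell0"
  by (rule subspaceI)
    (auto simp: mem_ell0 fun_eq_iff plus_bcontfun.rep_eq[abs_def] zero_bcontfun.rep_eq[abs_def]
      scaleR_bcontfun.rep_eq[abs_def] intro!: tendsto_add_zero tendsto_scaleR[OF tendsto_const, of _ 0, simplified])

lemma closed_ell0: "closed (ell0 :: (int \<Rightarrow>\<^sub>C (real^'d)) set)"
  unfolding closed_sequential_limits
proof safe
  fix f :: "nat \<Rightarrow> int \<Rightarrow>\<^sub>C (real^'d)" and l assume f: "\<forall>n. f n \<in> ell0" and lim: "f \<longlonglongrightarrow> l"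
  show "l \<in> ell0" unfolding mem_ell0
  proof (rule tendstoI)
    fix e :: real assume "e > 0"
    then obtain n where n: "dist (f n) l < e / 2"
      using lim half_gt_zero unfolding lim_sequentially by blast
    have "eventually (\<lambda>k. dist (f n k) 0 < e / 2) (sup at_top at_bot)"
      using f \<open>e > 0\<close> unfolding mem_ell0 by (intro tendstoD) auto
    then show "eventually (\<lambda>k. dist (l k) 0 < e) (sup at_top at_bot)"
    proof eventually_elim
      case (elim k)
      have "dist (l k) 0 \<le> dist (f n k) (l k) + dist (f n k) 0" by (rule dist_triangle3)
      then show ?case using elim n dist_bounded[of "f n" k l] by linarith
    qed
  qed
qed

text \<open>The library instance of completeness needs a metric on the index type, which
  \<^typ>\<open>int\<close> does not have.\<close>
lemma complete_ell0: "complete (ell0 :: (int \<Rightarrow>\<^sub>C (real^'d)) set)"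
  unfolding complete_def
proof (intro allI impI, elim conjE)
  fix f :: "nat \<Rightarrow> int \<Rightarrow>\<^sub>C (real^'d)" assume f: "\<forall>n. f n \<in> ell0" and "Cauchy f"
  then obtain g where "uniform_limit UNIV f g sequentially"
    using uniformly_convergent_eq_cauchy[of "\<lambda>_. True" f]
    unfolding Cauchy_def uniform_limit_sequentially_iff
    by (metis dist_fun_lt_imp_dist_val_lt)
  from uniform_limit_bcontfunE[OF this sequentially_bot]
  obtain l where "f \<longlonglongrightarrow> l" by metis
  then show "\<exists>l\<in>ell0. f \<longlonglongrightarrow> l"
    using f closed_ell0 unfolding closed_sequential_limits by blast
qed

subsection \<open>The difference operator of an asymptotically hyperbolic system\<close>

text \<open>The rates \<open>1/4\<close> on the range of \<open>p\<close> and \<open>4\<close> on its kernel make the map \<open>step\<close> below a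
  contraction with constant \<open>1/2\<close>.\<close>
definition dich :: "real^'d^'d \<Rightarrow> real^'d^'d" where
  "dich p = mat 4 - (15/4) *\<^sub>R p"

lemma mat_mult_vec: "mat c *v x = c *\<^sub>R x" for x :: "real^'d"
  by (simp add: vec_eq_iff matrix_vector_mult_def mat_def if_distrib[of "\<lambda>t. t * _"] cong: if_cong)

lemma dich_apply: "dich p *v x = 4 *\<^sub>R x - (15/4) *\<^sub>R (p *v x)"
  unfolding dich_def
  by (simp add: matrix_vector_mult_diff_rdistrib mat_mult_vec scaleR_matrix_vector_assoc)

text \<open>The inverse exchanges the two rates: \<open>1/4 + 15/4 = 4\<close> on the range of
  \<open>p\<close>, and \<open>1/4\<close> on its kernel.\<close>

lemma invertible_dich:
  assumes "orth_proj p W"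
  shows "invertible (dich p)"
proof -
  have "(mat (1/4) + (15/4) *\<^sub>R p) ** dich p = mat 1"
    unfolding matrix_eq
    by (simp add: dich_apply matrix_vector_mult_add_rdistrib mat_mult_vec orth_proj_idem[OF assms]
        matrix_vector_mult_diff_distrib matrix_vector_mult_scaleR vec_eq_iff algebra_simps
        flip: matrix_vector_mul_assoc scaleR_matrix_vector_assoc)
  then show ?thesis using invertible_left_inverse by blast
qed

text \<open>The equation at \<open>n\<close> links \<open>u n\<close> with \<open>u (n + 1)\<close>.
  With index 0 counted to the forward half, the two half-line problems share exactly the value
  \<open>u 0\<close>.\<close>

definition coef :: "real^'d^'d \<Rightarrow> real^'d^'d \<Rightarrow> int \<Rightarrow> real^'d^'d" where
  "coef p q n = dich (if 0 \<le> n then p else q)"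

definition Lop :: "real^'d^'d \<Rightarrow> real^'d^'d \<Rightarrow> (int \<Rightarrow>\<^sub>C (real^'d)) \<Rightarrow> (int \<Rightarrow>\<^sub>C (real^'d))" where
  "Lop p q u = Bcontfun (\<lambda>n. u (n + 1) - coef p q n *v u n)"

lemma norm_coef_le: "norm (coef p q n *v x) \<le> (4 + 4 * (norm p + norm q)) * norm x"
proof -
  define r where "r = (if 0 \<le> n then p else q)"
  have "norm (coef p q n *v x) \<le> norm (4 *\<^sub>R x) + norm ((15/4) *\<^sub>R (r *v x))"
    unfolding coef_def dich_apply r_def by (rule norm_triangle_ineq4)
  also have "\<dots> \<le> 4 * norm x + 4 * (norm r * norm x)"
    using norm_matrix_vector_le[of r x] norm_ge_zero[of "r *v x"] unfolding norm_scaleR by linarith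
  also have "\<dots> \<le> 4 * norm x + 4 * ((norm p + norm q) * norm x)"
    by (intro add_left_mono mult_left_mono mult_right_mono) (auto simp: r_def)
  finally show ?thesis by (simp add: algebra_simps)
qed

text \<open>The sequence in the definition is bounded for every bounded \<open>u\<close>, so the
  abstraction by \<open>Bcontfun\<close> never yields a junk value, and linearity holds without
  membership in \<open>ell0\<close>.\<close>

lemma Lop_apply: "Lop p q u n = u (n + 1) - coef p q n *v u n"
proof -
  have "(\<lambda>n. u (n + 1) - coef p q n *v u n) \<in> bcontfun"
  proof (rule bcontfun_normI)
    fix n
    have "norm (u (n + 1) - coef p q n *v u n) \<le> norm (u (n + 1)) + norm (coef p q n *v u n)"
      by (rule norm_triangle_ineq4)
    also have "\<dots> \<le> norm u + (4 + 4 * (norm p + norm q)) * norm u"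
      by (intro add_mono norm_bounded order_trans[OF norm_coef_le] mult_left_mono) auto
    finally show "norm (u (n + 1) - coef p q n *v u n) \<le> norm u + (4 + 4 * (norm p + norm q)) * norm u" .
  qed simp
  then show ?thesis unfolding Lop_def by (simp add: Bcontfun_inverse)
qed

lemma Lop_add: "Lop p q (u + v) = Lop p q u + Lop p q v"
  by (rule bcontfun_eqI) (simp add: Lop_apply matrix_vector_right_distrib)

lemma Lop_scaleR: "Lop p q (c *\<^sub>R u) = c *\<^sub>R Lop p q u"
  by (rule bcontfun_eqI) (simp add: Lop_apply matrix_vector_mult_scaleR scaleR_diff_right)

lemma Lop_diff: "Lop p q (u - v) = Lop p q u - Lop p q v"
  by (rule bcontfun_eqI) (simp add: Lop_apply matrix_vector_mult_diff_distrib)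

text \<open>One estimate with three uses: equal projections and \<open>u' = 0\<close> give
  boundedness of the operator, \<open>u = u'\<close> gives norm continuity in the parameter, and the
  general case gives joint continuity.\<close>

lemma Lop_diff_bound:
  "norm (Lop p q u - Lop p' q' u') \<le>
     (5 + 4 * (norm p + norm q)) * norm (u - u') + 4 * (norm (p - p') + norm (q - q')) * norm u'"
proof (rule norm_bound)
  fix n :: int
  define r where "r = (if 0 \<le> n then p - p' else q - q')"
  have "(coef p q n - coef p' q' n) *v u' n = - ((15/4) *\<^sub>R (r *v u' n))"
    by (simp add: r_def coef_def matrix_vector_mult_diff_rdistrib dich_apply algebra_simps)
  then have eq: "(Lop p q u - Lop p' q' u') n =
      (u - u') (n + 1) - coef p q n *v (u - u') n + (15/4) *\<^sub>R (r *v u' n)"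
    by (simp add: Lop_apply matrix_vector_mult_diff_distrib matrix_vector_mult_diff_rdistrib algebra_simps)
  have 1: "norm ((u - u') (n + 1)) \<le> norm (u - u')" by (rule norm_bounded)
  have 2: "norm (coef p q n *v (u - u') n) \<le> (4 + 4 * (norm p + norm q)) * norm (u - u')"
    by (intro order_trans[OF norm_coef_le] mult_left_mono norm_bounded) auto
  have "norm (r *v u' n) \<le> norm r * norm (u' n)" by (rule norm_matrix_vector_le)
  also have "\<dots> \<le> (norm (p - p') + norm (q - q')) * norm u'"
    by (intro mult_mono norm_bounded) (auto simp: r_def)
  finally have 3: "norm ((15/4) *\<^sub>R (r *v u' n)) \<le> 4 * ((norm (p - p') + norm (q - q')) * norm u')"
    using norm_ge_zero[of "r *v u' n"] unfolding norm_scaleR by linarith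
  have "norm ((Lop p q u - Lop p' q' u') n) \<le>
      norm ((u - u') (n + 1)) + norm (coef p q n *v (u - u') n) + norm ((15/4) *\<^sub>R (r *v u' n))"
    unfolding eq by (intro order_trans[OF norm_triangle_ineq] add_right_mono norm_triangle_ineq4)
  also have "\<dots> \<le> norm (u - u') + (4 + 4 * (norm p + norm q)) * norm (u - u') +
      4 * ((norm (p - p') + norm (q - q')) * norm u')"
    by (intro add_mono 1 2 3)
  also have "\<dots> = (5 + 4 * (norm p + norm q)) * norm (u - u') + 4 * (norm (p - p') + norm (q - q')) * norm u'"
    by (simp add: algebra_simps)
  finally show "norm ((Lop p q u - Lop p' q' u') n) \<le>
     (5 + 4 * (norm p + norm q)) * norm (u - u') + 4 * (norm (p - p') + norm (q - q')) * norm u'" .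
qed

lemma continuous_on_Lop:
  assumes "continuous_on S p" "continuous_on S q" "continuous_on S u"
  shows "continuous_on S (\<lambda>z. Lop (p z) (q z) (u z))"
  unfolding continuous_on_def
proof
  fix z0 assume z0: "z0 \<in> S"
  have t: "(p \<longlongrightarrow> p z0) (at z0 within S)" "(q \<longlongrightarrow> q z0) (at z0 within S)" "(u \<longlongrightarrow> u z0) (at z0 within S)"
    using assms z0 unfolding continuous_on_def by auto
  have "((\<lambda>z. (5 + 4 * (norm (p z) + norm (q z))) * norm (u z - u z0) +
      4 * (norm (p z - p z0) + norm (q z - q z0)) * norm (u z0)) \<longlongrightarrow>
      (5 + 4 * (norm (p z0) + norm (q z0))) * norm (u z0 - u z0) +
      4 * (norm (p z0 - p z0) + norm (q z0 - q z0)) * norm (u z0)) (at z0 within S)"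
    by (intro tendsto_intros t)
  then have lim: "((\<lambda>z. (5 + 4 * (norm (p z) + norm (q z))) * norm (u z - u z0) +
      4 * (norm (p z - p z0) + norm (q z - q z0)) * norm (u z0)) \<longlongrightarrow> 0) (at z0 within S)"
    by simp
  have "((\<lambda>z. Lop (p z) (q z) (u z) - Lop (p z0) (q z0) (u z0)) \<longlongrightarrow> 0) (at z0 within S)"
    by (rule Lim_null_comparison[OF always_eventually lim]) (intro allI Lop_diff_bound)
  then show "((\<lambda>z. Lop (p z) (q z) (u z)) \<longlongrightarrow> Lop (p z0) (q z0) (u z0)) (at z0 within S)"
    by (rule LIM_zero_cancel)
qed

lemma Lop_ell0: "u \<in> ell0 \<Longrightarrow> Lop p q u \<in> ell0"
proof -
  assume u: "u \<in> ell0"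
  let ?C = "4 + 4 * (norm p + norm q)"
  have "norm (Lop p q u n) \<le> (1 + ?C) * (norm (u (n - 1)) + norm (u n) + norm (u (n + 1)) + norm (u (n - 1)) + norm (u n))" for n
  proof -
    have "norm (Lop p q u n) \<le> norm (u (n + 1)) + norm (coef p q n *v u n)"
      unfolding Lop_apply by (rule norm_triangle_ineq4)
    also have "\<dots> \<le> norm (u (n + 1)) + ?C * norm (u n)" by (intro add_left_mono norm_coef_le)
    also have "\<dots> \<le> (1 + ?C) * norm (u (n + 1)) + (1 + ?C) * norm (u n)"
      using mult_right_mono[of 1 "1 + ?C" "norm (u (n + 1))"] norm_ge_zero[of "u n"]
      by (simp add: algebra_simps)
    also have "\<dots> = (1 + ?C) * (norm (u n) + norm (u (n + 1)))" by (simp add: algebra_simps)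
    also have "\<dots> \<le> (1 + ?C) * (norm (u (n - 1)) + norm (u n) + norm (u (n + 1)) + norm (u (n - 1)) + norm (u n))"
      by (intro mult_left_mono) auto
    finally show ?thesis .
  qed
  then have "(apply_bcontfun (Lop p q u) \<longlongrightarrow> 0) (sup at_top at_bot)"
    by (intro null_dominated[OF u u])
  then show ?thesis by (simp add: mem_ell0)
qed

subsection \<open>Solvability\<close>

text \<open>The index map \<open>a\<close> is left free so that the same series serves both
  half-lines.\<close>

lemma summable_geometric_bcontfun:
  "summable (\<lambda>k. (1/4)^k *\<^sub>R apply_bcontfun y (a k :: int))" for y :: "int \<Rightarrow>\<^sub>C (real^'d)"
proof (rule summable_comparison_test[OF exI])
  show "\<forall>n\<ge>0. norm ((1/4)^n *\<^sub>R y (a n)) \<le> (1/4)^n * norm y"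
    by (auto intro!: mult_left_mono norm_bounded)
  show "summable (\<lambda>n. (1/4)^n * norm y)" by (intro summable_mult2 summable_geometric) auto
qed

lemma bounded_linear_geometric_sum:
  "bounded_linear (\<lambda>y :: int \<Rightarrow>\<^sub>C (real^'d). \<Sum>k. (1/4)^k *\<^sub>R apply_bcontfun y (a k))"
proof (rule bounded_linear_intro)
  fix x y :: "int \<Rightarrow>\<^sub>C (real^'d)" and r
  show "(\<Sum>k. (1/4)^k *\<^sub>R (x + y) (a k)) = (\<Sum>k. (1/4)^k *\<^sub>R x (a k)) + (\<Sum>k. (1/4)^k *\<^sub>R y (a k))"
    by (simp add: scaleR_add_right suminf_add summable_geometric_bcontfun)
  show "(\<Sum>k. (1/4)^k *\<^sub>R (r *\<^sub>R x) (a k)) = r *\<^sub>R (\<Sum>k. (1/4)^k *\<^sub>R x (a k))"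
    by (simp add: suminf_scaleR_right summable_geometric_bcontfun mult.commute)
  have "norm (\<Sum>k. (1/4)^k *\<^sub>R x (a k)) \<le> (\<Sum>k. (1/4)^k * norm x)"
    by (intro norm_suminf_le summable_mult2 summable_geometric) (auto intro!: mult_left_mono norm_bounded)
  also have "\<dots> = norm x * (\<Sum>k. (1/4)^k)"
    using suminf_mult[of "\<lambda>k. (1/4::real)^k" "norm x"] by (simp add: summable_geometric mult.commute)
  finally show "norm (\<Sum>k. (1/4)^k *\<^sub>R x (a k)) \<le> norm x * (\<Sum>k. (1/4)^k)" .
qed

text \<open>The initial value of the only forward bounded solution of
  \<open>u (n + 1) = 4 u n + y n\<close>: iterating gives
  \<open>u 0 = - \<Sum> 4^(-k-1) y k\<close>.\<close>

definition Sp :: "(int \<Rightarrow>\<^sub>C (real^'d)) \<Rightarrow> real^'d" where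
  "Sp y = - (1/4) *\<^sub>R (\<Sum>k. (1/4)^k *\<^sub>R y (int k))"

text \<open>The value at 0 of the only backward bounded solution of
  \<open>u (n + 1) = (1/4) u n + y n\<close>, unrolled into the past.\<close>

definition Sm :: "(int \<Rightarrow>\<^sub>C (real^'d)) \<Rightarrow> real^'d" where
  "Sm y = (\<Sum>k. (1/4)^k *\<^sub>R y (- 1 - int k))"

lemma bounded_linear_Sp: "bounded_linear Sp"
  unfolding Sp_def[abs_def]
  by (rule bounded_linear_compose[OF bounded_linear_scaleR_right bounded_linear_geometric_sum])

lemma bounded_linear_Sm: "bounded_linear Sm"
  unfolding Sm_def[abs_def] by (rule bounded_linear_geometric_sum)

lemmas Sp_linear = bounded_linear.linear[OF bounded_linear_Sp, THEN linear_diff]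
  bounded_linear.linear[OF bounded_linear_Sp, THEN linear_add]
  bounded_linear.linear[OF bounded_linear_Sp, THEN linear_scale]
  bounded_linear.linear[OF bounded_linear_Sp, THEN linear_sum]

lemmas Sm_linear = bounded_linear.linear[OF bounded_linear_Sm, THEN linear_diff]
  bounded_linear.linear[OF bounded_linear_Sm, THEN linear_add]
  bounded_linear.linear[OF bounded_linear_Sm, THEN linear_scale]
  bounded_linear.linear[OF bounded_linear_Sm, THEN linear_sum]

lemma Sp_single: "(\<And>n. n > 0 \<Longrightarrow> y n = 0) \<Longrightarrow> Sp y = - (1/4) *\<^sub>R y 0" for y :: "int \<Rightarrow>\<^sub>C (real^'d)"
  unfolding Sp_def by (subst suminf_finite[of "{0}"]) auto

lemma Sm_single: "(\<And>n. n < -1 \<Longrightarrow> y n = 0) \<Longrightarrow> Sm y = y (-1)" for y :: "int \<Rightarrow>\<^sub>C (real^'d)"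
  unfolding Sm_def by (subst suminf_finite[of "{0}"]) auto

locale dichotomy =
  fixes p q :: "real^'d^'d" and E F :: "(real^'d) set"
  assumes p: "orth_proj p E" and q: "orth_proj q F"
begin

text \<open>Forward boundedness fixes the component of \<open>x\<close> orthogonal to
  \<open>E\<close>, backward boundedness the component in \<open>F\<close>; these two constraints
  may be incompatible, whence the cokernel.\<close>

definition solvable :: "real^'d \<Rightarrow> (int \<Rightarrow>\<^sub>C (real^'d)) \<Rightarrow> bool" where
  "solvable x y \<longleftrightarrow> x - Sp y \<in> E \<and> q *v (x - Sm y) = 0"

lemma geometric_null: "(\<lambda>k. (1/4)^k *\<^sub>R (r *v apply_bcontfun u (a k))) \<longlonglongrightarrow> 0" for r :: "real^'d^'d"
proof (rule Lim_null_comparison[OF always_eventually])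
  show "\<forall>k. norm ((1/4)^k *\<^sub>R (r *v u (a k))) \<le> (1/4)^k * (norm r * norm u)"
    by (auto intro!: mult_left_mono order_trans[OF norm_matrix_vector_le] norm_bounded)
  show "(\<lambda>k. (1/4)^k * (norm r * norm u)) \<longlonglongrightarrow> 0"
    by (intro tendsto_mult_left_zero LIMSEQ_power_zero) simp
qed

lemma Lop_nonneg: "0 \<le> n \<Longrightarrow> Lop p q u n = u (n + 1) - 4 *\<^sub>R u n + (15/4) *\<^sub>R (p *v u n)"
  by (simp add: Lop_apply coef_def dich_apply)

lemma Lop_neg: "n < 0 \<Longrightarrow> Lop p q u n = u (n + 1) - 4 *\<^sub>R u n + (15/4) *\<^sub>R (q *v u n)"
  by (simp add: Lop_apply coef_def dich_apply)

lemmas mv_simps = matrix_vector_mult_diff_distrib matrix_vector_right_distrib matrix_vector_mult_scaleR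
  orth_proj_idem[OF p] orth_proj_idem[OF q]

text \<open>Both sums telescope along the solution.\<close>
lemma solvable_necessary: "solvable (u 0) (Lop p q u)" for u :: "int \<Rightarrow>\<^sub>C (real^'d)"
proof -
  let ?y = "Lop p q u" and ?r = "mat 1 - p"
  have r: "?r *v x = x - p *v x" for x by (simp add: matrix_vector_mult_diff_rdistrib)
  \<comment> \<open>The weight cancels the growth by 4 on the complement of \<open>E\<close>, so
    that increments of \<open>?f\<close> contain the source alone.\<close>
  let ?f = "\<lambda>k. (1/4)^k *\<^sub>R (?r *v u (int k))"
  have 1: "?f (Suc k) - ?f k = ?r *v ((1/4) *\<^sub>R ((1/4)^k *\<^sub>R ?y (int k)))" for k
    by (simp add: r Lop_nonneg mv_simps vec_eq_iff algebra_simps)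
  have "(\<lambda>k. ?f (Suc k) - ?f k) sums (0 - ?f 0)"
    by (rule telescope_sums[OF geometric_null])
  moreover have "(\<lambda>k. ?r *v ((1/4) *\<^sub>R ((1/4)^k *\<^sub>R ?y (int k)))) sums (?r *v ((1/4) *\<^sub>R (\<Sum>k. (1/4)^k *\<^sub>R ?y (int k))))"
    by (intro bounded_linear.sums[OF matrix_vector_mul_bounded_linear] sums_scaleR_right
        summable_sums summable_geometric_bcontfun)
  ultimately have "?r *v ((1/4) *\<^sub>R (\<Sum>k. (1/4)^k *\<^sub>R ?y (int k))) = 0 - ?f 0"
    unfolding 1 using sums_unique2 by blast
  then have "?r *v (u 0 - Sp ?y) = 0"
    by (simp add: Sp_def matrix_vector_right_distrib)
  then have E: "u 0 - Sp ?y \<in> E" by (simp add: r orth_proj_in_iff[OF p])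
  \<comment> \<open>Backward in time the range of \<open>q\<close> is the expanding part, and the
    same weight cancels its growth.\<close>
  let ?g = "\<lambda>k. (1/4)^k *\<^sub>R (q *v u (- int k))"
  have 2: "?g k - ?g (Suc k) = q *v ((1/4)^k *\<^sub>R ?y (- 1 - int k))" for k
    by (simp add: Lop_neg mv_simps vec_eq_iff algebra_simps)
  have "(\<lambda>k. ?g k - ?g (Suc k)) sums (?g 0 - 0)"
    by (rule telescope_sums'[OF geometric_null])
  moreover have "(\<lambda>k. q *v ((1/4)^k *\<^sub>R ?y (- 1 - int k))) sums (q *v (Sm ?y))"
    unfolding Sm_def
    by (intro bounded_linear.sums[OF matrix_vector_mul_bounded_linear]
        summable_sums summable_geometric_bcontfun)
  ultimately have "q *v Sm ?y = ?g 0 - 0"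
    unfolding 2 using sums_unique2 by blast
  then show ?thesis using E unfolding solvable_def by (simp add: mv_simps)
qed

text \<open>Each component is solved in its stable direction: on the range of \<open>r\<close> from
  the equation at \<open>n - 1\<close>, on its complement from the equation at \<open>n\<close>
  solved for \<open>u n\<close>. Both directions put the factor \<open>1/4\<close> on a neighbour of
  \<open>u n\<close>. The value at 0 is pinned to \<open>x\<close>.\<close>

definition step :: "real^'d \<Rightarrow> (int \<Rightarrow>\<^sub>C (real^'d)) \<Rightarrow> (int \<Rightarrow>\<^sub>C (real^'d)) \<Rightarrow> int \<Rightarrow> real^'d" where
  "step x y u n = (if n = 0 then x else
     let r = (if 0 < n then p else q); v = (1/4) *\<^sub>R (u (n + 1) - y n)
     in r *v ((1/4) *\<^sub>R u (n - 1) + y (n - 1)) + (v - r *v v))"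

lemma step_bound:
  assumes "n \<noteq> 0"
  shows "norm (step x y u n) \<le> (1/4) * norm (u (n - 1)) + norm (y (n - 1)) + (1/4) * norm (u (n + 1)) + (1/4) * norm (y n)"
proof -
  define r where "r = (if 0 < n then p else q)"
  define v where "v = (1/4) *\<^sub>R (u (n + 1) - y n)"
  have r: "norm (r *v w) \<le> norm w" "norm (w - r *v w) \<le> norm w" for w
    unfolding r_def using orth_proj_norm[OF p] orth_proj_norm[OF q] by auto
  have "norm (step x y u n) \<le> norm (r *v ((1/4) *\<^sub>R u (n - 1) + y (n - 1))) + norm (v - r *v v)"
    using assms unfolding step_def by (simp add: Let_def flip: r_def v_def) (rule norm_triangle_ineq)
  also have "\<dots> \<le> norm ((1/4) *\<^sub>R u (n - 1) + y (n - 1)) + norm v"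
    by (intro add_mono r)
  also have "norm ((1/4) *\<^sub>R u (n - 1) + y (n - 1)) \<le> (1/4) * norm (u (n - 1)) + norm (y (n - 1))"
    using norm_triangle_ineq[of "(1/4) *\<^sub>R u (n - 1)" "y (n - 1)"] by simp
  also have "norm v \<le> (1/4) * norm (u (n + 1)) + (1/4) * norm (y n)"
    using norm_triangle_ineq4[of "u (n + 1)" "y n"] unfolding v_def by simp
  finally show ?thesis by simp
qed

lemma step_pos:
  assumes "0 < n"
  shows "p *v step x y u n = p *v ((1/4) *\<^sub>R u (n - 1) + y (n - 1))"
    and "step x y u n - p *v step x y u n =
      (1/4) *\<^sub>R (u (n + 1) - y n) - p *v ((1/4) *\<^sub>R (u (n + 1) - y n))"
  using assms by (simp_all add: step_def Let_def mv_simps)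

lemma step_neg:
  assumes "n < 0"
  shows "q *v step x y u n = q *v ((1/4) *\<^sub>R u (n - 1) + y (n - 1))"
    and "step x y u n - q *v step x y u n =
      (1/4) *\<^sub>R (u (n + 1) - y n) - q *v ((1/4) *\<^sub>R (u (n + 1) - y n))"
  using assms by (simp_all add: step_def Let_def mv_simps)

text \<open>Every bounded sequence is a fixed point of \<open>step\<close> for its own initial value
  and source, so that \<open>step_bound\<close> turns into an estimate for \<open>u\<close>.\<close>

lemma step_Lop: "step (u 0) (Lop p q u) u n = u n" for u :: "int \<Rightarrow>\<^sub>C (real^'d)"
proof -
  consider "n = 0" | "0 < n" | "n < 0" by linarith
  then show ?thesis
  proof cases
    case 2
    then have "0 \<le> n - 1" "0 \<le> n" by auto
    with 2 show ?thesis unfolding step_def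
      by (simp add: Lop_nonneg Let_def mv_simps vec_eq_iff algebra_simps)
  next
    case 3
    then have "n - 1 < 0" by auto
    with 3 show ?thesis unfolding step_def
      by (simp add: Lop_neg Let_def mv_simps vec_eq_iff algebra_simps)
  qed (simp add: step_def)
qed

text \<open>Two neighbours with weight \<open>1/4\<close> contribute half of the norm of
  \<open>u\<close>, which is absorbed on the left; \<open>5/2\<close> is rounded up to 3. The
  constants do not depend on \<open>p\<close> and \<open>q\<close>. This yields uniqueness and,
  later, continuous dependence.\<close>

lemma Lop_apriori: "norm u \<le> 2 * norm (u 0) + 3 * norm (Lop p q u)" for u :: "int \<Rightarrow>\<^sub>C (real^'d)"
proof -
  let ?y = "Lop p q u"
  have "norm (u n) \<le> norm (u 0) + (1/2) * norm u + (5/4) * norm ?y" for n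
  proof (cases "n = 0")
    case False
    have "norm (u n) \<le> (1/4) * norm (u (n - 1)) + norm (?y (n - 1)) + (1/4) * norm (u (n + 1)) + (1/4) * norm (?y n)"
      using step_bound[OF False, of "u 0" ?y u] by (simp add: step_Lop)
    also have "\<dots> \<le> (1/4) * norm u + norm ?y + (1/4) * norm u + (1/4) * norm ?y"
      by (intro add_mono mult_left_mono norm_bounded) auto
    also have "\<dots> \<le> norm (u 0) + (1/2) * norm u + (5/4) * norm ?y" by simp
    finally show ?thesis .
  qed simp
  then have "norm u \<le> norm (u 0) + (1/2) * norm u + (5/4) * norm ?y" by (rule norm_bound)
  then show ?thesis using norm_ge_zero[of ?y] by linarith
qed

text \<open>A fixed point of \<^const>\<open>step\<close> solves the equation up to an error at \<open>n = -1, 0\<close>, and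
  \<open>solvable_necessary\<close> forces that error to vanish.\<close>
lemma solution_exists:
  assumes y: "y \<in> ell0" and xy: "solvable x y"
  shows "\<exists>u\<in>ell0. apply_bcontfun u 0 = x \<and> Lop p q u = y"
proof -
  have null: "(step x y u \<longlongrightarrow> 0) (sup at_top at_bot)" if u: "u \<in> ell0" for u
  proof (rule null_dominated[OF u y])
    fix n :: int assume n: "n \<noteq> 0"
    have aux: "t \<le> 1 * (a + b + c + d + e)"
      if "t \<le> (1/4) * a + d + (1/4) * c + (1/4) * e" "0 \<le> a" "0 \<le> b" "0 \<le> c" "0 \<le> e" for a b c d e t :: real
      using that by simp
    show "norm (step x y u n) \<le> 1 * (norm (u (n - 1)) + norm (u n) + norm (u (n + 1)) + norm (y (n - 1)) + norm (y n))"
      by (rule aux[OF step_bound[OF n]]) auto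
  qed
  define \<Phi> where "\<Phi> u = Bcontfun (step x y u)" for u
  have \<Phi>: "\<Phi> u \<in> ell0" "apply_bcontfun (\<Phi> u) = step x y u" if "u \<in> ell0" for u
    unfolding \<Phi>_def using null_imp_ell0[OF null[OF that]] by auto
  have "\<exists>!u\<in>ell0. \<Phi> u = u"
  proof (rule Banach_fix[where c = "1/2"])
    show "complete (ell0 :: (int \<Rightarrow>\<^sub>C (real^'d)) set)" by (rule complete_ell0)
    show "(ell0 :: (int \<Rightarrow>\<^sub>C (real^'d)) set) \<noteq> {}" using subspace_0[OF subspace_ell0] by blast
    show "\<Phi> ` ell0 \<subseteq> ell0" using \<Phi> by auto
    fix u v :: "int \<Rightarrow>\<^sub>C (real^'d)" assume uv: "u \<in> ell0" "v \<in> ell0"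
    show "dist (\<Phi> u) (\<Phi> v) \<le> 1/2 * dist u v"
      unfolding dist_norm
    proof (rule norm_bound)
      fix n :: int
      show "norm ((\<Phi> u - \<Phi> v) n) \<le> 1/2 * norm (u - v)"
      proof (cases "n = 0")
        case False
        \<comment> \<open>\<open>step\<close> is affine: off 0 the difference of two values is
          \<open>step\<close> with source 0, and \<open>step_bound\<close> leaves only
          \<open>1/4 + 1/4\<close>.\<close>
        have "(\<Phi> u - \<Phi> v) n = step x 0 (u - v) n"
          using False uv \<Phi>(2) by (simp add: step_def Let_def mv_simps algebra_simps)
        then have "norm ((\<Phi> u - \<Phi> v) n) \<le> (1/4) * norm ((u - v) (n - 1)) + (1/4) * norm ((u - v) (n + 1))"
          using step_bound[OF False, of x 0 "u - v"] by simp
        also have "\<dots> \<le> (1/4) * norm (u - v) + (1/4) * norm (u - v)"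
          by (intro add_mono mult_left_mono norm_bounded) auto
        finally show ?thesis by simp
      qed (use uv \<Phi>(2) in \<open>simp add: step_def\<close>)
    qed
  qed auto
  then obtain u where u: "u \<in> ell0" "\<Phi> u = u" by blast
  have fix_u: "u n = step x y u n" for n using \<Phi>(2)[OF u(1)] u(2) by simp
  have u0: "u 0 = x" using fix_u[of 0] by (simp add: step_def)
  define z where "z = Lop p q u - y"
  have zn: "z n = Lop p q u n - y n" for n unfolding z_def by simp
  \<comment> \<open>The \<open>p\<close>-part of the equation at \<open>n\<close> is the fixed point
    relation at \<open>n + 1\<close>, hence available from \<open>n = 0\<close>. The complementary
    part is the relation at \<open>n\<close> itself, hence available only from
    \<open>n = 1\<close>.\<close>
  have pz: "p *v z n = 0" if "n \<ge> 0" for n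
  proof -
    have "p *v u (n + 1) = p *v ((1/4) *\<^sub>R u n + y n)"
      using that step_pos(1)[of "n + 1" x y u] fix_u[of "n + 1"] by simp
    then show ?thesis
      using that by (simp add: zn Lop_nonneg mv_simps vec_eq_iff algebra_simps)
  qed
  have pz': "z n = p *v z n" if "n > 0" for n
  proof -
    have "z n - p *v z n = 4 *\<^sub>R ((1/4) *\<^sub>R (u (n + 1) - y n) - p *v ((1/4) *\<^sub>R (u (n + 1) - y n)) - (u n - p *v u n))"
      using that by (simp add: zn Lop_nonneg mv_simps vec_eq_iff algebra_simps)
    also have "\<dots> = 0"
      using step_pos(2)[OF that, of x y u] unfolding fix_u[symmetric] by simp
    finally show ?thesis by simp
  qed
  \<comment> \<open>The same shift on the negative side: the \<open>q\<close>-part is lost at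
    \<open>n = -1\<close>, because the relation at 0 was replaced by the initial value.\<close>
  have qz: "q *v z n = 0" if "n < -1" for n
  proof -
    have "q *v u (n + 1) = q *v ((1/4) *\<^sub>R u n + y n)"
      using that step_neg(1)[of "n + 1" x y u] fix_u[of "n + 1"] by simp
    then show ?thesis
      using that by (simp add: zn Lop_neg mv_simps vec_eq_iff algebra_simps)
  qed
  have qz': "z n = q *v z n" if "n < 0" for n
  proof -
    have "z n - q *v z n = 4 *\<^sub>R ((1/4) *\<^sub>R (u (n + 1) - y n) - q *v ((1/4) *\<^sub>R (u (n + 1) - y n)) - (u n - q *v u n))"
      using that by (simp add: zn Lop_neg mv_simps vec_eq_iff algebra_simps)
    also have "\<dots> = 0"
      using step_neg(2)[OF that, of x y u] unfolding fix_u[symmetric] by simp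
    finally show ?thesis by simp
  qed
  have zpos: "z n = 0" if "n > 0" for n using that pz[of n] pz'[of n] by simp
  have zneg: "z n = 0" if "n < -1" for n using that qz[of n] qz'[of n] by simp
  have nec: "x - Sp (Lop p q u) \<in> E" "q *v (x - Sm (Lop p q u)) = 0"
    using solvable_necessary[of u] u0 unfolding solvable_def by auto
  have suf: "x - Sp y \<in> E" "q *v (x - Sm y) = 0"
    using xy unfolding solvable_def by auto
  have "Sp z = Sp (Lop p q u) - Sp y" "Sm z = Sm (Lop p q u) - Sm y"
    unfolding z_def by (simp_all add: Sp_linear Sm_linear)
  then have S: "Sp z = (x - Sp y) - (x - Sp (Lop p q u))" "Sm z = (x - Sm y) - (x - Sm (Lop p q u))"
    by auto
  have "Sp z \<in> E" unfolding S(1) using subspace_diff[OF orth_proj_subspace[OF p]] nec suf by blast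
  \<comment> \<open>As \<open>z\<close> lives on \<open>{-1, 0}\<close>, the functionals reduce to
    \<open>Sp z = - z 0 / 4\<close> and \<open>Sm z = z (-1)\<close>. So \<open>z 0\<close> lies in
    \<open>E\<close> while \<open>p\<close> kills it, and \<open>z (-1)\<close> lies in
    \<open>F\<close> while \<open>q\<close> kills it.\<close>
  then have "(-4) *\<^sub>R Sp z \<in> E" by (rule subspace_scale[OF orth_proj_subspace[OF p]])
  then have "z 0 \<in> E" using Sp_single[of z, OF zpos] by simp
  then have z0: "z 0 = 0" using pz[of 0] orth_proj_id[OF p] by simp
  have "q *v Sm z = 0" unfolding S(2) matrix_vector_mult_diff_distrib[of q "x - Sm y"] using nec suf by simp
  then have z1: "z (-1) = 0" using Sm_single[of z, OF zneg] qz'[of "-1"] by simp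
  have "z n = 0" for n
  proof -
    consider "n > 0" | "n = 0" | "n = -1" | "n < -1" by linarith
    then show ?thesis using zpos zneg z0 z1 by cases auto
  qed
  then have "z = 0" by (intro bcontfun_eqI) simp
  then show ?thesis using u(1) u0 unfolding z_def by auto
qed

lemma solution_unique:
  assumes "apply_bcontfun u 0 = apply_bcontfun v 0" "Lop p q u = Lop p q v"
  shows "u = v"
  using Lop_apriori[of "u - v"] assms by (simp add: Lop_diff)

lemma range_Lop: "Lop p q ` ell0 = {y \<in> ell0. \<exists>x. solvable x y}"
proof (intro equalityI subsetI)
  fix y assume "y \<in> Lop p q ` ell0"
  then show "y \<in> {y \<in> ell0. \<exists>x. solvable x y}"
    using solvable_necessary Lop_ell0 by auto
next
  fix y assume "y \<in> {y \<in> ell0. \<exists>x. solvable x y}"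
  then obtain x where "y \<in> ell0" "solvable x y" by blast
  from solution_exists[OF this] show "y \<in> Lop p q ` ell0" by auto
qed

end

text \<open>Defined outside the locale, from matrices and data only, so that it can be studied as a
  function of all four arguments. By \<open>solution_unique\<close> the choice is determined
  whenever the data are solvable.\<close>

definition solution :: "real^'d^'d \<Rightarrow> real^'d^'d \<Rightarrow> real^'d \<Rightarrow> (int \<Rightarrow>\<^sub>C (real^'d)) \<Rightarrow> (int \<Rightarrow>\<^sub>C (real^'d))" where
  "solution p q x y = (SOME u. u \<in> ell0 \<and> apply_bcontfun u 0 = x \<and> Lop p q u = y)"

context dichotomy
begin

lemma solution:
  assumes "y \<in> ell0" "solvable x y"
  shows "solution p q x y \<in> ell0" "apply_bcontfun (solution p q x y) 0 = x" "Lop p q (solution p q x y) = y"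
proof -
  have "\<exists>u. u \<in> ell0 \<and> apply_bcontfun u 0 = x \<and> Lop p q u = y"
    using solution_exists[OF assms] by blast
  from someI_ex[OF this, folded solution_def]
  show "solution p q x y \<in> ell0" "apply_bcontfun (solution p q x y) 0 = x" "Lop p q (solution p q x y) = y"
    by auto
qed

lemma solution_Lop: "u \<in> ell0 \<Longrightarrow> solution p q (apply_bcontfun u 0) (Lop p q u) = u"
  by (rule solution_unique) (simp_all add: solution Lop_ell0 solvable_necessary)

end

text \<open>The solution at \<open>z0\<close> is frozen and fed into the operator at
  \<open>z\<close>, where its image tends to \<open>y z0\<close>. \<open>Lop_apriori\<close> at
  \<open>z\<close> then bounds the difference of the two solutions, with uniform constants.\<close>

lemma continuous_on_solution:
  assumes P: "continuous_on S p" "continuous_on S q" "continuous_on S x" "continuous_on S y"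
    and dich: "\<And>z. z \<in> S \<Longrightarrow> dichotomy (p z) (q z) (E z) (F z)"
    and y: "\<And>z. z \<in> S \<Longrightarrow> y z \<in> ell0"
    and sol: "\<And>z. z \<in> S \<Longrightarrow> dichotomy.solvable (q z) (E z) (x z) (y z)"
  shows "continuous_on S (\<lambda>z. solution (p z) (q z) (x z) (y z))"
  unfolding continuous_on_def
proof
  fix z0 assume z0: "z0 \<in> S"
  let ?u = "\<lambda>z. solution (p z) (q z) (x z) (y z)"
  note so = dichotomy.solution[OF dich y sol]
  have t: "(x \<longlongrightarrow> x z0) (at z0 within S)" "(y \<longlongrightarrow> y z0) (at z0 within S)"
    using P z0 unfolding continuous_on_def by auto
  have "continuous_on S (\<lambda>z. Lop (p z) (q z) (?u z0))"
    by (intro continuous_on_Lop P continuous_on_const)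
  then have L: "((\<lambda>z. Lop (p z) (q z) (?u z0)) \<longlongrightarrow> y z0) (at z0 within S)"
    using z0 so(3)[OF z0 z0 z0] unfolding continuous_on_def by auto
  have "((\<lambda>z. 2 * norm (x z - x z0) + 3 * norm (y z - Lop (p z) (q z) (?u z0))) \<longlongrightarrow>
      2 * norm (x z0 - x z0) + 3 * norm (y z0 - y z0)) (at z0 within S)"
    by (intro tendsto_intros t L)
  then have lim: "((\<lambda>z. 2 * norm (x z - x z0) + 3 * norm (y z - Lop (p z) (q z) (?u z0))) \<longlongrightarrow> 0) (at z0 within S)"
    by simp
  have le: "norm (?u z - ?u z0) \<le> 2 * norm (x z - x z0) + 3 * norm (y z - Lop (p z) (q z) (?u z0))" if z: "z \<in> S" for z
    using dichotomy.Lop_apriori[OF dich[OF z], of "?u z - ?u z0"] so(2,3)[OF z z z] so(2)[OF z0 z0 z0]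
    by (simp add: Lop_diff)
  have "((\<lambda>z. ?u z - ?u z0) \<longlongrightarrow> 0) (at z0 within S)"
    by (rule Lim_null_comparison[OF _ lim]) (auto simp: eventually_at_filter le)
  then show "(?u \<longlongrightarrow> ?u z0) (at z0 within S)" by (rule LIM_zero_cancel)
qed

subsection \<open>Fredholm property\<close>

text \<open>Writing \<open>x = e + Sp y\<close> turns the backward condition into one on
  \<open>e + jump y\<close>: the source enters only through the mismatch of the two half-line
  values.\<close>

definition jump :: "(int \<Rightarrow>\<^sub>C (real^'d)) \<Rightarrow> real^'d" where
  "jump y = Sp y - Sm y"

lemma bounded_linear_jump: "bounded_linear jump"
  unfolding jump_def[abs_def] by (intro bounded_linear_sub bounded_linear_Sp bounded_linear_Sm)

lemmas linear_jump = bounded_linear.linear[OF bounded_linear_jump]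

lemma bounded_linear_eval: "bounded_linear (\<lambda>u :: int \<Rightarrow>\<^sub>C (real^'d). apply_bcontfun u n)"
  by (rule bounded_linear_intro[of _ 1]) (auto simp: norm_bounded)

text \<open>A source at \<open>-1\<close> is invisible to \<open>Sp\<close> and has weight 1 in
  \<open>Sm\<close>, so \<open>jump (delta x) = - x\<close>. These sources realise every mismatch,
  with no reference to the parameter.\<close>

definition delta :: "real^'d \<Rightarrow> (int \<Rightarrow>\<^sub>C (real^'d))" where
  "delta x = Bcontfun (\<lambda>n. if n = -1 then x else 0)"

lemma delta_ell0: "delta x \<in> ell0" and delta_apply: "apply_bcontfun (delta x) n = (if n = -1 then x else 0)"
proof -
  have "eventually (\<lambda>n::int. (if n = -1 then x else 0) = 0) (sup at_top at_bot)"
    unfolding eventually_sup eventually_at_top_linorder eventually_at_bot_linorder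
    by (intro conjI exI[of _ 0] exI[of _ "-2"]) auto
  then have "((\<lambda>n::int. if n = -1 then x else 0) \<longlongrightarrow> 0) (sup at_top at_bot)"
    by (rule tendsto_eventually)
  from null_imp_ell0[OF this] show "delta x \<in> ell0" "apply_bcontfun (delta x) n = (if n = -1 then x else 0)"
    unfolding delta_def by auto
qed

lemma Sp_delta: "Sp (delta x) = 0"
  by (subst Sp_single) (auto simp: delta_apply)

lemma Sm_delta: "Sm (delta x) = x"
  by (subst Sm_single) (auto simp: delta_apply)

lemma fin_dim_range_delta: "fin_dim_subspace (range (delta :: real^'d \<Rightarrow> _))"
proof -
  have "linear (delta :: real^'d \<Rightarrow> _)"
    by (rule linearI) (auto intro!: bcontfun_eqI simp: delta_apply)
  then have "span (delta ` Basis) = delta ` span (Basis :: (real^'d) set)"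
    by (rule linear_span_image)
  then show ?thesis
    unfolding fin_dim_subspace_def by (intro exI[of _ "delta ` Basis"]) auto
qed

context dichotomy
begin

lemma solvable_iff: "solvable (e + Sp v) v \<longleftrightarrow> e \<in> E \<and> q *v (e + jump v) = 0"
  unfolding solvable_def jump_def by (simp add: algebra_simps)

lemma bounded_linear_on_Lop: "bounded_linear_on ell0 (Lop p q)"
proof -
  have "norm (Lop p q u) \<le> (5 + 4 * (norm p + norm q)) * norm u" for u
    using Lop_diff_bound[of p q u p q 0] Lop_scaleR[of p q 0 u] by simp
  then show ?thesis
    unfolding bounded_linear_on_def using Lop_ell0 by (auto simp: Lop_add Lop_scaleR)
qed

text \<open>Evaluation at 0 is injective on the kernel, so independent sets there map to independent
  sets in \<open>real^'d\<close>.\<close>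

lemma fin_dim_kernel_Lop: "fin_dim_subspace {u \<in> ell0. Lop p q u = 0}"
proof -
  let ?K = "{u \<in> ell0. Lop p q u = 0}" and ?ev = "\<lambda>u :: int \<Rightarrow>\<^sub>C (real^'d). apply_bcontfun u 0"
  have sub: "subspace ?K"
    using subspace_ell0 Lop_scaleR[of p q 0 0]
    by (auto simp: subspace_def Lop_add Lop_scaleR)
  obtain C where C: "C \<subseteq> ?K" "independent C" "?K \<subseteq> span C"
    using maximal_independent_subset[of ?K] by blast
  have K: "span C = ?K" using C sub by (intro equalityI span_minimal) auto
  have "inj_on ?ev (span C)"
    unfolding K by (rule inj_onI, rule solution_unique) auto
  then have "independent (?ev ` C)"
    using linear_independent_injective_image[OF bounded_linear.linear[OF bounded_linear_eval] C(2)] by blast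
  then have "finite (?ev ` C)" by (rule finiteI_independent)
  then have "finite C"
    using \<open>inj_on ?ev (span C)\<close> by (rule finite_imageD[OF _ inj_on_subset[OF _ span_superset]])
  then show ?thesis unfolding fin_dim_subspace_def using K by blast
qed

text \<open>Solvability says that \<open>q *v jump y\<close> lies in the image of \<open>E\<close>
  under \<open>q\<close>. The range is thus the preimage in \<open>ell0\<close> of a
  finite-dimensional, hence closed, subspace under a continuous map.\<close>

lemma closed_range_Lop: "closed (Lop p q ` ell0)"
proof -
  have "(\<exists>x. solvable x y) \<longleftrightarrow> q *v jump y \<in> (*v) q ` E" for y
  proof
    assume "\<exists>x. solvable x y"
    then obtain x where "solvable ((x - Sp y) + Sp y) y" by auto
    then have e: "x - Sp y \<in> E" "q *v ((x - Sp y) + jump y) = 0" unfolding solvable_iff by auto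
    then have "q *v jump y = q *v (- (x - Sp y))"
      by (simp add: matrix_vector_right_distrib matrix_vector_mult_diff_distrib algebra_simps)
    then show "q *v jump y \<in> (*v) q ` E"
      using subspace_neg[OF orth_proj_subspace[OF p] e(1)] by blast
  next
    assume "q *v jump y \<in> (*v) q ` E"
    then obtain e where "e \<in> E" "q *v jump y = q *v e" by blast
    then have "solvable (- e + Sp y) y"
      unfolding solvable_iff using subspace_neg[OF orth_proj_subspace[OF p], of e]
      by (simp add: matrix_vector_mult_diff_distrib)
    then show "\<exists>x. solvable x y" by blast
  qed
  then have "Lop p q ` ell0 = ell0 \<inter> (\<lambda>y. q *v jump y) -` ((*v) q ` E)"
    unfolding range_Lop by auto
  moreover have "closed ((*v) q ` E)"
    by (intro closed_subspace linear_subspace_image matrix_vector_mul_linear orth_proj_subspace[OF p])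
  moreover have "continuous_on UNIV (\<lambda>y. q *v jump y)"
    by (intro linear_continuous_on bounded_linear_compose[OF matrix_vector_mul_bounded_linear]
        bounded_linear_jump)
  ultimately show ?thesis
    using closed_ell0 closed_vimage by (metis closed_Int)
qed

text \<open>Subtracting a suitable \<open>delta\<close> makes the jump vanish, and then
  \<open>e = 0\<close> solves the matching condition. One complement thus serves all
  parameters.\<close>

lemma range_Lop_plus_delta: "{y + w |y w. y \<in> Lop p q ` ell0 \<and> w \<in> range delta} = ell0"
proof (intro equalityI subsetI)
  fix y assume "y \<in> {y + w |y w. y \<in> Lop p q ` ell0 \<and> w \<in> range delta}"
  then show "y \<in> ell0" by (auto intro!: subspace_add[OF subspace_ell0] Lop_ell0 delta_ell0)
next
  fix y :: "int \<Rightarrow>\<^sub>C (real^'d)" assume y: "y \<in> ell0"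
  define v where "v = delta (Sm y - Sp y)"
  have "jump (y - v) = 0"
    unfolding jump_def v_def by (simp add: Sp_linear Sm_linear Sp_delta Sm_delta)
  then have "solvable (0 + Sp (y - v)) (y - v)"
    unfolding solvable_iff using subspace_0[OF orth_proj_subspace[OF p]] by simp
  moreover have "y - v \<in> ell0" using y delta_ell0 subspace_diff[OF subspace_ell0] unfolding v_def by blast
  ultimately have "y - v \<in> Lop p q ` ell0" unfolding range_Lop by blast
  moreover have "y = (y - v) + v" by simp
  ultimately show "y \<in> {y + w |y w. y \<in> Lop p q ` ell0 \<and> w \<in> range delta}" unfolding v_def by blast
qed

lemma fredholm_Lop: "fredholm_on ell0 (Lop p q)"
  unfolding fredholm_on_def
  using bounded_linear_on_Lop fin_dim_kernel_Lop closed_range_Lop range_Lop_plus_delta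
    fin_dim_range_delta delta_ell0
  by (intro conjI exI[of _ "range delta"]) auto

text \<open>Transversality is tested on the source \<open>delta (- f)\<close>, whose jump is
  \<open>f\<close>. Splitting it as \<open>Lop p q u + v\<close> and applying the necessary
  condition to \<open>u\<close> expresses \<open>f\<close> through \<open>E\<close> and
  \<open>V\<close>.\<close>

lemma transversal_surj:
  assumes V: "{y + v |y v. y \<in> Lop p q ` ell0 \<and> v \<in> V} = ell0" and f: "f \<in> F"
  shows "\<exists>e\<in>E. \<exists>v\<in>V. q *v (e + jump v) = f"
proof -
  have "delta (- f) \<in> {y + v |y v. y \<in> Lop p q ` ell0 \<and> v \<in> V}" unfolding V by (rule delta_ell0)
  then obtain u v where v: "v \<in> V" and eq: "delta (- f) = Lop p q u + v" by auto
  have L: "Lop p q u = delta (- f) - v" using eq by simp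
  let ?e = "apply_bcontfun u 0 - Sp (Lop p q u)"
  have "solvable (?e + Sp (Lop p q u)) (Lop p q u)" using solvable_necessary[of u] by simp
  then have e: "?e \<in> E" "q *v (?e + jump (Lop p q u)) = 0" unfolding solvable_iff by auto
  have "jump (Lop p q u) = f - jump v"
    unfolding L jump_def by (simp add: Sp_linear Sm_linear Sp_delta Sm_delta)
  then have "- ?e + jump v = f - (?e + jump (Lop p q u))" by simp
  then have "q *v (- ?e + jump v) = q *v f"
    using e(2) by (simp only: matrix_vector_mult_diff_distrib) simp
  also have "\<dots> = f" by (rule orth_proj_id[OF q f])
  finally show ?thesis using v subspace_neg[OF orth_proj_subspace[OF p] e(1)] by blast
qed

end

subsection \<open>The index bundle\<close>

text \<open>This is \<open>J J^T\<close> for the map \<open>J\<close> sending coefficients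
  \<open>c\<close> on \<open>B\<close> to the sum of \<open>c b *\<^sub>R jump b\<close>. The inner
  product on the \<open>V\<close> side is thus the one on coefficients.\<close>

definition gram :: "(int \<Rightarrow>\<^sub>C (real^'d)) set \<Rightarrow> real^'d^'d" where
  "gram B = (\<chi> i j. \<Sum>b\<in>B. jump b $ i * jump b $ j)"

lemma gram_apply: "gram B *v x = (\<Sum>b\<in>B. (jump b \<bullet> x) *\<^sub>R jump b)"
proof -
  have "(\<Sum>j\<in>UNIV. (\<Sum>b\<in>B. jump b $ i * jump b $ j) * x $ j) = (\<Sum>b\<in>B. (jump b \<bullet> x) * jump b $ i)" for i
    unfolding inner_vec_def sum_distrib_right by (subst sum.swap) (simp add: mult_ac)
  then show ?thesis by (simp add: gram_def matrix_vector_mult_def vec_eq_iff)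
qed

text \<open>With \<open>T (e, v) = q (e + jump v)\<close> from \<open>E \<times> span B\<close> onto \<open>F\<close>, this is \<open>T T\<^sup>*\<close> on \<open>F\<close>, extended
  by the identity on the orthogonal complement of \<open>F\<close>.\<close>
definition normal_mat :: "(int \<Rightarrow>\<^sub>C (real^'d)) set \<Rightarrow> real^'d^'d \<Rightarrow> real^'d^'d \<Rightarrow> real^'d^'d" where
  "normal_mat B p q = q ** ((p + gram B) ** q) + (mat 1 - q)"

definition rinv :: "(int \<Rightarrow>\<^sub>C (real^'d)) set \<Rightarrow> real^'d^'d \<Rightarrow> real^'d^'d \<Rightarrow> real^'d \<Rightarrow> (real^'d) \<times> (int \<Rightarrow>\<^sub>C (real^'d))" where
  "rinv B p q f = (let g = matrix_inv (normal_mat B p q) *v f in (p *v g, \<Sum>b\<in>B. (jump b \<bullet> g) *\<^sub>R b))"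

lemma normal_mat_apply: "normal_mat B p q *v x = q *v (p *v (q *v x) + gram B *v (q *v x)) + (x - q *v x)"
  unfolding normal_mat_def
  by (simp add: matrix_vector_mult_add_rdistrib matrix_vector_mult_diff_rdistrib flip: matrix_vector_mul_assoc)

lemma rinv_add: "rinv B p q (f + g) = rinv B p q f + rinv B p q g"
  unfolding rinv_def Let_def
  by (simp add: matrix_vector_right_distrib inner_add_right scaleR_add_left sum.distrib)

lemma rinv_scaleR: "rinv B p q (c *\<^sub>R f) = c *\<^sub>R rinv B p q f"
  unfolding rinv_def Let_def
  by (simp add: matrix_vector_mult_scaleR scaleR_sum_right)

locale transversal = dichotomy p q E F
  for p q :: "real^'d^'d" and E F :: "(real^'d) set" +
  fixes B :: "(int \<Rightarrow>\<^sub>C (real^'d)) set"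
  assumes B: "finite B" "span B \<subseteq> ell0"
    and surj: "\<And>f. f \<in> F \<Longrightarrow> \<exists>e\<in>E. \<exists>v\<in>span B. q *v (e + jump v) = f"
begin

text \<open>\<open>normal_mat\<close> respects the splitting into \<open>F\<close> and its
  complement and is the identity on the latter, so preimages of vectors of \<open>F\<close> stay in
  \<open>F\<close>.\<close>

lemma normal_mat_preimage:
  assumes "normal_mat B p q *v g \<in> F"
  shows "g \<in> F" "q *v (p *v g + gram B *v g) = normal_mat B p q *v g"
proof -
  have "g - q *v g = normal_mat B p q *v g - q *v (p *v (q *v g) + gram B *v (q *v g))"
    by (simp add: normal_mat_apply)
  also have "\<dots> \<in> F" using assms orth_proj_in[OF q] subspace_diff[OF orth_proj_subspace[OF q]] by blast
  finally have "q *v (g - q *v g) = g - q *v g" by (rule orth_proj_id[OF q])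
  then have "q *v g = g" by (simp add: mv_simps)
  then show "g \<in> F" "q *v (p *v g + gram B *v g) = normal_mat B p q *v g"
    by (simp_all add: orth_proj_in_iff[OF q] normal_mat_apply)
qed

text \<open>If \<open>T T^* g = 0\<close> then pairing with \<open>g\<close> gives
  \<open>T^* g = 0\<close>, so \<open>g\<close> is orthogonal to the image of \<open>T\<close>. That
  image is all of \<open>F\<close> and contains \<open>g\<close>.\<close>

lemma invertible_normal_mat: "invertible (normal_mat B p q)"
proof -
  have "g = 0" if 0: "normal_mat B p q *v g = 0" for g
  proof -
    have "normal_mat B p q *v g \<in> F" using 0 subspace_0[OF orth_proj_subspace[OF q]] by simp
    from normal_mat_preimage[OF this] have g: "g \<in> F" "q *v (p *v g + gram B *v g) = 0"
      using 0 by auto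
    have "0 = (q *v (p *v g + gram B *v g)) \<bullet> g" using g(2) by simp
    also have "\<dots> = (p *v g + gram B *v g) \<bullet> g" by (rule orth_proj_inner[OF q g(1)])
    also have "\<dots> = (p *v g) \<bullet> (p *v g) + (\<Sum>b\<in>B. (jump b \<bullet> g)\<^sup>2)"
      using orth_proj_sym[OF p, of "p *v g" g]
      by (simp add: inner_add_left gram_apply inner_sum_left power2_eq_square orth_proj_idem[OF p])
    finally have "(p *v g) \<bullet> (p *v g) + (\<Sum>b\<in>B. (jump b \<bullet> g)\<^sup>2) = 0" by simp
    then have z: "(p *v g) \<bullet> (p *v g) = 0" "(\<Sum>b\<in>B. (jump b \<bullet> g)\<^sup>2) = 0"
      by (simp_all add: add_nonneg_eq_0_iff sum_nonneg)
    have pg: "p *v g = 0" using z(1) by simp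
    have Bg: "jump b \<bullet> g = 0" if "b \<in> B" for b
      using z(2) that B(1) by (simp add: sum_nonneg_eq_0_iff)
    have "subspace {v. jump v \<bullet> g = 0}"
      by (auto simp: subspace_def linear_0[OF linear_jump] linear_add[OF linear_jump]
          linear_scale[OF linear_jump] inner_add_left)
    then have Vg: "span B \<subseteq> {v. jump v \<bullet> g = 0}" using Bg by (intro span_minimal) auto
    obtain e v where ev: "e \<in> E" "v \<in> span B" "q *v (e + jump v) = g" using surj[OF g(1)] by blast
    have "g \<bullet> g = (q *v (e + jump v)) \<bullet> g" by (simp add: ev(3))
    also have "\<dots> = (e + jump v) \<bullet> g" by (rule orth_proj_inner[OF q g(1)])
    also have "\<dots> = (p *v e) \<bullet> g + jump v \<bullet> g" using orth_proj_id[OF p ev(1)] by (simp add: inner_add_left)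
    also have "\<dots> = e \<bullet> (p *v g) + jump v \<bullet> g" by (simp only: orth_proj_sym[OF p])
    also have "\<dots> = 0" using pg Vg ev(2) by auto
    finally show "g = 0" by simp
  qed
  then show ?thesis
    using matrix_left_invertible_ker invertible_left_inverse by blast
qed

lemma rinv:
  assumes "f \<in> F"
  shows "fst (rinv B p q f) \<in> E" "snd (rinv B p q f) \<in> span B"
    "q *v (fst (rinv B p q f) + jump (snd (rinv B p q f))) = f"
proof -
  define g where "g = matrix_inv (normal_mat B p q) *v f"
  have g: "normal_mat B p q *v g = f"
    unfolding g_def by (rule invertible_mult_inv[OF invertible_normal_mat])
  have r: "rinv B p q f = (p *v g, \<Sum>b\<in>B. (jump b \<bullet> g) *\<^sub>R b)"
    unfolding rinv_def g_def Let_def ..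
  show "fst (rinv B p q f) \<in> E" "snd (rinv B p q f) \<in> span B"
    unfolding r by (auto intro!: orth_proj_in[OF p] span_sum span_scale intro: span_base)
  have "jump (\<Sum>b\<in>B. (jump b \<bullet> g) *\<^sub>R b) = gram B *v g"
    unfolding gram_apply by (simp add: linear_sum[OF linear_jump] linear_scale[OF linear_jump])
  then show "q *v (fst (rinv B p q f) + jump (snd (rinv B p q f))) = f"
    unfolding r using normal_mat_preimage(2)[of g] g assms by simp
qed

end

section \<open>The isomorphism of (index bundle) \<oplus> F with E \<oplus> V\<close>

definition iso_to :: "(int \<Rightarrow>\<^sub>C (real^'d)) set \<Rightarrow> real^'d^'d \<Rightarrow> real^'d^'d \<Rightarrow>
    (int \<Rightarrow>\<^sub>C (real^'d)) \<times> (real^'d) \<Rightarrow> (real^'d) \<times> (int \<Rightarrow>\<^sub>C (real^'d))" where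
  "iso_to B p q w = (apply_bcontfun (fst w) 0 - Sp (Lop p q (fst w)), Lop p q (fst w)) + rinv B p q (snd w)"

text \<open>The first summand of \<open>iso_to\<close> lies in the kernel of \<open>T\<close> and
  \<open>rinv\<close> is a right inverse, so applying \<open>T\<close> recovers the
  \<open>F\<close>-component. What remains after removing \<open>rinv\<close> is solvable
  data.\<close>

definition iso_fro :: "(int \<Rightarrow>\<^sub>C (real^'d)) set \<Rightarrow> real^'d^'d \<Rightarrow> real^'d^'d \<Rightarrow>
    (real^'d) \<times> (int \<Rightarrow>\<^sub>C (real^'d)) \<Rightarrow> (int \<Rightarrow>\<^sub>C (real^'d)) \<times> (real^'d)" where
  "iso_fro B p q w = (let f = q *v (fst w + jump (snd w)); w' = w - rinv B p q f
     in (solution p q (fst w' + Sp (snd w')) (snd w'), f))"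

lemma iso_to_add: "iso_to B p q (v + w) = iso_to B p q v + iso_to B p q w"
  unfolding iso_to_def by (simp add: Lop_add rinv_add Sp_linear)

lemma iso_to_scaleR: "iso_to B p q (c *\<^sub>R w) = c *\<^sub>R iso_to B p q w"
  unfolding iso_to_def by (simp add: Lop_scaleR rinv_scaleR Sp_linear scaleR_diff_right scaleR_add_right)

context transversal
begin

lemma split_solvable:
  assumes "w \<in> E \<times> span B" "f = q *v (fst w + jump (snd w))" "w' = w - rinv B p q f"
  shows "f \<in> F" "snd w' \<in> span B" "solvable (fst w' + Sp (snd w')) (snd w')"
proof -
  show f: "f \<in> F" unfolding assms(2) by (rule orth_proj_in[OF q])
  note r = rinv[OF f]
  show "snd w' \<in> span B" using assms(1,3) r(2) by (auto intro: span_diff)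
  have "fst w' \<in> E" using assms(1,3) r(1) subspace_diff[OF orth_proj_subspace[OF p]] by auto
  moreover have "q *v (fst w' + jump (snd w')) = 0"
  proof -
    have "fst w' + jump (snd w') = (fst w + jump (snd w)) - (fst (rinv B p q f) + jump (snd (rinv B p q f)))"
      unfolding assms(3) by (simp add: linear_diff[OF linear_jump])
    then show ?thesis using r(3) assms(2) by (simp add: matrix_vector_mult_diff_distrib)
  qed
  ultimately show "solvable (fst w' + Sp (snd w')) (snd w')" unfolding solvable_iff ..
qed

lemma iso_fro_to:
  assumes "u \<in> ell0" "Lop p q u \<in> span B" "f \<in> F"
  shows "iso_to B p q (u, f) \<in> E \<times> span B" "iso_fro B p q (iso_to B p q (u, f)) = (u, f)"
proof -
  note r = rinv[OF assms(3)]
  let ?e = "apply_bcontfun u 0 - Sp (Lop p q u)"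
  have "solvable (?e + Sp (Lop p q u)) (Lop p q u)" using solvable_necessary[of u] by simp
  then have e: "?e \<in> E" "q *v (?e + jump (Lop p q u)) = 0" unfolding solvable_iff by auto
  let ?w = "iso_to B p q (u, f)"
  show "?w \<in> E \<times> span B"
    unfolding iso_to_def using e(1) r(1,2) assms(2) subspace_add[OF orth_proj_subspace[OF p]]
    by (auto simp: mem_Times_iff intro: span_add)
  have "fst ?w + jump (snd ?w) = (?e + jump (Lop p q u)) + (fst (rinv B p q f) + jump (snd (rinv B p q f)))"
    unfolding iso_to_def by (simp add: linear_add[OF linear_jump])
  then have "q *v (fst ?w + jump (snd ?w)) = f"
    using e(2) r(3) by (simp only: matrix_vector_right_distrib[of q "?e + jump (Lop p q u)"]) simp
  moreover have "?w - rinv B p q f = (?e, Lop p q u)" unfolding iso_to_def by simp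
  ultimately show "iso_fro B p q ?w = (u, f)"
    unfolding iso_fro_def Let_def by (simp add: solution_Lop[OF assms(1)])
qed

lemma iso_to_fro:
  assumes w: "w \<in> E \<times> span B"
  shows "fst (iso_fro B p q w) \<in> ell0" "Lop p q (fst (iso_fro B p q w)) \<in> span B"
    "snd (iso_fro B p q w) \<in> F" "iso_to B p q (iso_fro B p q w) = w"
proof -
  define f where "f = q *v (fst w + jump (snd w))"
  define w' where "w' = w - rinv B p q f"
  note s = split_solvable[OF w f_def w'_def]
  have "snd w' \<in> ell0" using s(2) B(2) by blast
  note so = solution[OF this s(3)]
  have i: "iso_fro B p q w = (solution p q (fst w' + Sp (snd w')) (snd w'), f)"
    unfolding iso_fro_def Let_def f_def w'_def ..
  show "fst (iso_fro B p q w) \<in> ell0" "Lop p q (fst (iso_fro B p q w)) \<in> span B" "snd (iso_fro B p q w) \<in> F"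
    unfolding i using so s by auto
  have "iso_to B p q (iso_fro B p q w) = w' + rinv B p q f"
    unfolding i iso_to_def using so by (simp add: prod_eq_iff)
  then show "iso_to B p q (iso_fro B p q w) = w" unfolding w'_def by simp
qed

end

lemma continuous_on_rinv:
  assumes P: "continuous_on S p" "continuous_on S q" "continuous_on S f"
    and inv: "\<And>z. z \<in> S \<Longrightarrow> invertible (normal_mat B (p z) (q z))"
  shows "continuous_on S (\<lambda>z. rinv B (p z) (q z) (f z))"
proof -
  have "continuous_on S (\<lambda>z. normal_mat B (p z) (q z))"
    unfolding normal_mat_def by (intro continuous_intros continuous_on_matrix_mult P)
  then have g: "continuous_on S (\<lambda>z. matrix_inv (normal_mat B (p z) (q z)) *v f z)"
    by (intro continuous_on_matrix_inv_mult P inv)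
  show ?thesis
    unfolding rinv_def Let_def
    by (intro continuous_intros continuous_on_matrix_vector_mult P g)
qed

text \<open>Continuity is needed on total spaces, where base point and vector vary together;
  \<open>continuous_on_solution\<close> and \<open>continuous_on_rinv\<close> therefore allow all
  their arguments to depend on the point \<open>z\<close>. The spanning set \<open>B\<close> stays
  fixed.\<close>

lemma index_bundle_iso:
  fixes \<Lambda> :: "'a::metric_space set" and E F :: "'a \<Rightarrow> (real^'d) set"
  assumes P: "continuous_on \<Lambda> P" "continuous_on \<Lambda> Q"
    and tr: "\<And>l. l \<in> \<Lambda> \<Longrightarrow> transversal (P l) (Q l) (E l) (F l) B"
  shows "bundle_iso \<Lambda> (bsum (index_fibres ell0 (\<lambda>l. Lop (P l) (Q l)) (span B)) F) (bsum E (\<lambda>_. span B))"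
proof -
  let ?N = "index_fibres ell0 (\<lambda>l. Lop (P l) (Q l)) (span B)"
  let ?\<phi> = "\<lambda>l. iso_to B (P l) (Q l)" and ?\<psi> = "\<lambda>l. iso_fro B (P l) (Q l)"
  have dich: "dichotomy (P l) (Q l) (E l) (F l)" if "l \<in> \<Lambda>" for l
    using tr[OF that] unfolding transversal_def by blast
  have 1: "?\<phi> l w \<in> E l \<times> span B \<and> ?\<psi> l (?\<phi> l w) = w" if "l \<in> \<Lambda>" "w \<in> ?N l \<times> F l" for l w
    using transversal.iso_fro_to[OF tr[OF that(1)], of "fst w" "snd w"] that(2)
    by (auto simp: index_fibres_def)
  have 2: "?\<psi> l w \<in> ?N l \<times> F l \<and> ?\<phi> l (?\<psi> l w) = w" if "l \<in> \<Lambda>" "w \<in> E l \<times> span B" for l w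
    using transversal.iso_to_fro[OF tr[OF that(1)] that(2)]
    by (auto simp: index_fibres_def mem_Times_iff)
  have inv: "invertible (normal_mat B (P l) (Q l))" if "l \<in> \<Lambda>" for l
    by (rule transversal.invertible_normal_mat[OF tr[OF that]])
  have c\<phi>: "continuous_on (SIGMA l:\<Lambda>. ?N l \<times> F l) (\<lambda>z. ?\<phi> (fst z) (snd z))"
  proof -
    let ?S = "SIGMA l:\<Lambda>. ?N l \<times> F l"
    have PQ: "continuous_on ?S (\<lambda>z. P (fst z))" "continuous_on ?S (\<lambda>z. Q (fst z))"
      by (auto intro!: continuous_on_compose2[OF P(1)] continuous_on_compose2[OF P(2)] continuous_intros)
    have L: "continuous_on ?S (\<lambda>z. Lop (P (fst z)) (Q (fst z)) (fst (snd z)))"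
      by (intro continuous_on_Lop PQ continuous_intros)
    show ?thesis unfolding iso_to_def
      by (intro continuous_intros continuous_on_rinv PQ L
          bounded_linear.continuous_on[OF bounded_linear_Sp] bounded_linear.continuous_on[OF bounded_linear_eval])
        (auto intro: inv)
  qed
  have c\<psi>: "continuous_on (SIGMA l:\<Lambda>. E l \<times> span B) (\<lambda>z. ?\<psi> (fst z) (snd z))"
  proof -
    let ?S = "SIGMA l:\<Lambda>. E l \<times> span B"
    have PQ: "continuous_on ?S (\<lambda>z. P (fst z))" "continuous_on ?S (\<lambda>z. Q (fst z))"
      by (auto intro!: continuous_on_compose2[OF P(1)] continuous_on_compose2[OF P(2)] continuous_intros)
    define f where "f z = Q (fst z) *v (fst (snd z) + jump (snd (snd z)))" for z :: "'a \<times> (real^'d) \<times> (int \<Rightarrow>\<^sub>C (real^'d))"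
    define w where "w z = snd z - rinv B (P (fst z)) (Q (fst z)) (f z)" for z
    have cf: "continuous_on ?S f"
      unfolding f_def
      by (intro continuous_on_matrix_vector_mult PQ continuous_intros
          bounded_linear.continuous_on[OF bounded_linear_jump])
    have cw: "continuous_on ?S w"
      unfolding w_def by (intro continuous_intros continuous_on_rinv PQ cf) (auto intro: inv)
    have s: "snd (w z) \<in> span B" "dichotomy.solvable (Q (fst z)) (E (fst z)) (fst (w z) + Sp (snd (w z))) (snd (w z))"
      if z: "z \<in> ?S" for z
    proof -
      have "fst z \<in> \<Lambda>" "snd z \<in> E (fst z) \<times> span B" using z by auto
      from transversal.split_solvable(2,3)[OF tr[OF this(1)] this(2) f_def w_def]
      show "snd (w z) \<in> span B" "dichotomy.solvable (Q (fst z)) (E (fst z)) (fst (w z) + Sp (snd (w z))) (snd (w z))"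
        by auto
    qed
    have "continuous_on ?S (\<lambda>z. solution (P (fst z)) (Q (fst z)) (fst (w z) + Sp (snd (w z))) (snd (w z)))"
    proof (rule continuous_on_solution[where E = "\<lambda>z. E (fst z)" and F = "\<lambda>z. F (fst z)"])
      fix z assume z: "z \<in> ?S"
      then have l: "fst z \<in> \<Lambda>" by auto
      show "dichotomy (P (fst z)) (Q (fst z)) (E (fst z)) (F (fst z))" by (rule dich[OF l])
      show "snd (w z) \<in> ell0"
        using s(1)[OF z] tr[OF l] unfolding transversal_def transversal_axioms_def by blast
      show "dichotomy.solvable (Q (fst z)) (E (fst z)) (fst (w z) + Sp (snd (w z))) (snd (w z))"
        by (rule s(2)[OF z])
    qed (intro PQ continuous_intros cw bounded_linear.continuous_on[OF bounded_linear_Sp])+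
    then have "continuous_on ?S (\<lambda>z. (solution (P (fst z)) (Q (fst z)) (fst (w z) + Sp (snd (w z))) (snd (w z)), f z))"
      by (intro continuous_intros cf)
    then show ?thesis unfolding iso_fro_def Let_def w_def f_def .
  qed
  show ?thesis
    unfolding bundle_iso_def bsum_def
    using 1 2 c\<phi> c\<psi> by (intro exI[of _ ?\<phi>] exI[of _ ?\<psi>]) (simp add: iso_to_add iso_to_scaleR case_prod_unfold)
qed

section \<open>Passage to KO-theory and the main result\<close>

lemma bundle_iso_bsum_right:
  assumes "bundle_iso \<Lambda> X Y"
  shows "bundle_iso \<Lambda> (bsum X G) (bsum Y G)"
proof -
  obtain \<phi> \<psi> where iso:
    "\<And>l u v. l \<in> \<Lambda> \<Longrightarrow> u \<in> X l \<Longrightarrow> v \<in> X l \<Longrightarrow> \<phi> l (u + v) = \<phi> l u + \<phi> l v"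
    "\<And>l c u. l \<in> \<Lambda> \<Longrightarrow> u \<in> X l \<Longrightarrow> \<phi> l (c *\<^sub>R u) = c *\<^sub>R \<phi> l u"
    "\<And>l u. l \<in> \<Lambda> \<Longrightarrow> u \<in> X l \<Longrightarrow> \<phi> l u \<in> Y l \<and> \<psi> l (\<phi> l u) = u"
    "\<And>l w. l \<in> \<Lambda> \<Longrightarrow> w \<in> Y l \<Longrightarrow> \<psi> l w \<in> X l \<and> \<phi> l (\<psi> l w) = w"
    "continuous_on (SIGMA l:\<Lambda>. X l) (\<lambda>(l, u). \<phi> l u)"
    "continuous_on (SIGMA l:\<Lambda>. Y l) (\<lambda>(l, w). \<psi> l w)"
    by (rule bundle_isoE[OF assms]) (rule that)
  have c: "continuous_on (SIGMA l:\<Lambda>. Z l \<times> G l) (\<lambda>(l, w). (h l (fst w), snd w))"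
    if "continuous_on (SIGMA l:\<Lambda>. Z l) (\<lambda>(l, u). h l u)" for Z :: "'a \<Rightarrow> 'x::real_normed_vector set" and h :: "'a \<Rightarrow> 'x \<Rightarrow> 'y::real_normed_vector"
  proof -
    have "continuous_on (SIGMA l:\<Lambda>. Z l \<times> G l) (\<lambda>z. (\<lambda>(l, u). h l u) (fst z, fst (snd z)))"
      by (rule continuous_on_compose2[OF that]) (auto intro!: continuous_intros)
    then have "continuous_on (SIGMA l:\<Lambda>. Z l \<times> G l) (\<lambda>z. (h (fst z) (fst (snd z)), snd (snd z)))"
      by (auto intro!: continuous_intros)
    then show ?thesis by (simp add: case_prod_unfold)
  qed
  show ?thesis
    unfolding bundle_iso_def bsum_def
    by (intro exI[of _ "\<lambda>l w. (\<phi> l (fst w), snd w)"] exI[of _ "\<lambda>l w. (\<psi> l (fst w), snd w)"] conjI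
        c[OF iso(5)] c[OF iso(6)])
      (auto simp: iso(1-4))
qed

text \<open>The zero bundle serves as the stabilising summand \<open>G\<close>.\<close>

lemma KO_eqI:
  assumes "bundle_iso \<Lambda> (bsum E1 F2) (bsum E2 F1)"
  shows "KO_eq \<Lambda> E1 F1 E2 F2"
  unfolding KO_eq_def
proof (intro exI conjI)
  have "fin_dim_subspace {0 :: nat \<Rightarrow>\<^sub>C real}"
    unfolding fin_dim_subspace_def by (intro exI[of _ "{}"]) simp
  then show "vbundle \<Lambda> (\<lambda>_. {0 :: nat \<Rightarrow>\<^sub>C real})" by (rule vbundle_const)
qed (rule bundle_iso_bsum_right[OF assms])

theorem theorem6p5:
  fixes \<Lambda> :: "'a::metric_space set"
    and E F :: "'a \<Rightarrow> (real^'d) set"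
  assumes "compact \<Lambda>" and "path_connected \<Lambda>"
    and "subbundle_of \<Lambda> UNIV E" and "subbundle_of \<Lambda> UNIV F"
  shows "\<exists>(A :: 'a \<Rightarrow> int \<Rightarrow> real^'d^'d) (L :: 'a \<Rightarrow> (int \<Rightarrow>\<^sub>C (real^'d)) \<Rightarrow> (int \<Rightarrow>\<^sub>C (real^'d))).
           (\<forall>n. continuous_on \<Lambda> (\<lambda>l. A l n)) \<and>
           (\<forall>l\<in>\<Lambda>. \<forall>n. invertible (A l n)) \<and>
           (\<forall>l\<in>\<Lambda>. \<forall>\<phi>\<in>ell0. L l \<phi> \<in> ell0 \<and>
               (\<forall>n. apply_bcontfun (L l \<phi>) n = apply_bcontfun \<phi> (n + 1) - A l n *v apply_bcontfun \<phi> n)) \<and>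
           op_family_continuous \<Lambda> ell0 L \<and>
           (\<forall>l\<in>\<Lambda>. fredholm_on ell0 (L l)) \<and>
           index_bundle_eq \<Lambda> ell0 L E F"
proof -
  have E: "vbundle \<Lambda> E" and F: "vbundle \<Lambda> F" using assms(3,4) unfolding subbundle_of_def by auto
  obtain P where P: "continuous_on \<Lambda> P" "\<And>l. l \<in> \<Lambda> \<Longrightarrow> orth_proj (P l) (E l)"
    by (rule vbundle_orth_proj[OF E]) (rule that)
  obtain Q where Q: "continuous_on \<Lambda> Q" "\<And>l. l \<in> \<Lambda> \<Longrightarrow> orth_proj (Q l) (F l)"
    by (rule vbundle_orth_proj[OF F]) (rule that)
  have dich: "dichotomy (P l) (Q l) (E l) (F l)" if "l \<in> \<Lambda>" for l
    using P(2) Q(2) that by (simp add: dichotomy_def)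
  let ?A = "\<lambda>l. coef (P l) (Q l)" and ?L = "\<lambda>l. Lop (P l) (Q l)"
  have "continuous_on \<Lambda> (\<lambda>l. ?A l n)" for n
    unfolding coef_def dich_def by (cases "0 \<le> n") (auto intro!: continuous_intros P(1) Q(1))
  moreover have "invertible (?A l n)" if "l \<in> \<Lambda>" for l n
    using invertible_dich[OF P(2)[OF that]] invertible_dich[OF Q(2)[OF that]] unfolding coef_def by auto
  moreover have "op_family_continuous \<Lambda> ell0 ?L"
    unfolding op_family_continuous_def
  proof (intro ballI allI impI)
    fix l0 and e :: real assume l0: "l0 \<in> \<Lambda>" and e: "e > 0"
    have "continuous_on \<Lambda> (\<lambda>l. 4 * (norm (P l - P l0) + norm (Q l - Q l0)))"
      by (intro continuous_intros P(1) Q(1))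
    then obtain \<delta> where \<delta>: "\<delta> > 0" "\<And>l. l \<in> \<Lambda> \<Longrightarrow> dist l l0 < \<delta> \<Longrightarrow>
        dist (4 * (norm (P l - P l0) + norm (Q l - Q l0))) (4 * (norm (P l0 - P l0) + norm (Q l0 - Q l0))) < e"
      using l0 e unfolding continuous_on_iff by meson
    have "norm (?L l u - ?L l0 u) \<le> e * norm u" if "l \<in> \<Lambda>" "dist l l0 < \<delta>" for l u
    proof -
      have "4 * (norm (P l - P l0) + norm (Q l - Q l0)) \<le> e"
        using \<delta>(2)[OF that] by (simp add: dist_real_def)
      then have "4 * (norm (P l - P l0) + norm (Q l - Q l0)) * norm u \<le> e * norm u"
        by (intro mult_right_mono) auto
      then show ?thesis using Lop_diff_bound[of "P l" "Q l" u "P l0" "Q l0" u] by simp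
    qed
    then show "\<exists>\<delta>>0. \<forall>l\<in>\<Lambda>. dist l l0 < \<delta> \<longrightarrow> (\<forall>u\<in>ell0. norm (?L l u - ?L l0 u) \<le> e * norm u)"
      using \<delta>(1) by blast
  qed
  moreover have "fredholm_on ell0 (?L l)" if "l \<in> \<Lambda>" for l
    by (rule dichotomy.fredholm_Lop[OF dich[OF that]])
  moreover have "index_bundle_eq \<Lambda> ell0 ?L E F"
    unfolding index_bundle_eq_def
  proof (intro conjI allI impI)
    have "index_admissible \<Lambda> ell0 ?L (range delta)"
      unfolding index_admissible_def
      using fin_dim_range_delta delta_ell0 dichotomy.range_Lop_plus_delta[OF dich] by auto
    then show "\<exists>V. index_admissible \<Lambda> ell0 ?L V" ..
  next
    fix V assume V: "index_admissible \<Lambda> ell0 ?L V"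
    then have fd: "fin_dim_subspace V" unfolding index_admissible_def by blast
    then obtain B where B: "finite B" "V = span B" unfolding fin_dim_subspace_def by blast
    have "transversal (P l) (Q l) (E l) (F l) B" if "l \<in> \<Lambda>" for l
    proof -
      interpret dichotomy "P l" "Q l" "E l" "F l" by (rule dich[OF that])
      have "V \<subseteq> ell0" "{y + v |y v. y \<in> ?L l ` ell0 \<and> v \<in> V} = ell0"
        using V that unfolding index_admissible_def by auto
      with transversal_surj[OF this(2)] show ?thesis
        by unfold_locales (auto simp flip: B(2) intro: B(1))
    qed
    \<comment> \<open>This isomorphism is used twice: it makes the index fibres a bundle, as a
      summand of \<open>E \<oplus> V\<close>, and it is the identity required in KO.\<close>
    note iso = index_bundle_iso[OF P(1) Q(1) this, folded B(2)]
    have "subspace (index_fibres ell0 ?L V l)" for l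
      using subspace_ell0 subspace_span[of B] Lop_scaleR[of "P l" "Q l" 0 0]
      unfolding index_fibres_def B(2)[symmetric] subspace_def by (auto simp: Lop_add Lop_scaleR)
    then show "vbundle \<Lambda> (index_fibres ell0 ?L V)"
      using vbundle_summand[OF iso F vbundle_bsum[OF E vbundle_const[OF fd]]] by blast
    show "KO_eq \<Lambda> (index_fibres ell0 ?L V) (\<lambda>l. V) E F"
      by (rule KO_eqI[OF iso])
  qed
  ultimately show ?thesis
    by (intro exI[of _ ?A] exI[of _ ?L]) (auto simp: Lop_ell0 Lop_apply)
qed

end
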